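(* Let $(G,g,f)$ be a third-type datum and $H=\mathfrak A^3_G(g,f)$. Up to interchanging the two factors, exact factorizations $H=BT$ by proper Hopf subalgebras $B,T\subsetneq H$ are in bijection with pairs $(G_B,\Gamma)$ of subgroups of $G$ forming a nontrivial exact factorization $$G=G_B\Gamma,\qquad G_B\cap\Gamma=\{1\},\qquad g\in G_B,\qquad \Gamma\neq\{1\}.$$ The Hopf subalgebras corresponding to $(G_B,\Gamma)$ are $$B=\mathfrak A^3_{G_B}(g,f|_{G_B}),\qquad T=k[\Gamma].$$
   Context: $k$ is an algebraically closed field of characteristic $p>0$; all algebras, tensor products etc. are over $k$. A third-type datum is a triple $(G,g,f)$ where $G$ is a finite group, $g\in Z(G)$, $f:G\to(k,+)$ is a group homomorphism with $f(g)=1$, and $(f(t)^p-f(t))(1-g^p)=0$ in $k[G]$ for all $t\in G$. The Hopf algebra $\mathfrak A^3_G(g,f)$ is generated as an algebra by the group algebra $k[G]$ and an element $x$ subject to $tx-xt=f(t)\,t(1-g)$ for $t\in G$ and $x^p=x$, with $\Delta(t)=t\otimes t$, $\varepsilon(t)=1$, $S(t)=t^{-1}$ for $t\in G$, and $\Delta(x)=x\otimes 1+g\otimes x$, $\varepsilon(x)=0$, $S(x)=-g^{-1}x$. It has basis $\{tx^i\mid t\in G,\ 0\le i<p\}$. For a subgroup $G_B\le G$ containing $g$, $\mathfrak A^3_{G_B}(g,f|_{G_B})$ is identified with the Hopf subalgebra of $\mathfrak A^3_G(g,f)$ generated by $G_B$ and $x$. For Hopf subalgebras $B,T$ of a Hopf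 algebra $H$, $H=BT$ is an exact factorization if the multiplication map $B\otimes T\to H$, $b\otimes t\mapsto bt$, is bijective. *)

theory Defs
  imports
    "HOL-Algebra.Coset"
    "HOL-Library.Poly_Mapping"
    "HOL-Computational_Algebra.Computational_Algebra"
begin

section \<open>Free vector spaces\<close>

text \<open>
  The vector space with basis \<open>'i\<close> over a field \<open>'k\<close> is the type of finitely supported functions
  \<open>'i \<Rightarrow>\<^sub>0 'k\<close>; its elements are called formal sums.
\<close>

definition fscale :: "'k::field \<Rightarrow> ('i \<Rightarrow>\<^sub>0 'k) \<Rightarrow> ('i \<Rightarrow>\<^sub>0 'k)" where
  "fscale c = Poly_Mapping.map (\<lambda>d. c * d)"

definition fbasis :: "'i \<Rightarrow> ('i \<Rightarrow>\<^sub>0 'k::field)" where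
  "fbasis i = Poly_Mapping.single i 1"

lemma lookup_fscale: "Poly_Mapping.lookup (fscale c u) i = c * Poly_Mapping.lookup u i"
  by (simp add: fscale_def Poly_Mapping.map.rep_eq when_def)

lemma vector_space_fscale: "vector_space fscale"
  by unfold_locales
    (auto intro!: poly_mapping_eqI simp: lookup_fscale lookup_add algebra_simps)

definition lin_ext ::
  "('k::field \<Rightarrow> 'v::ab_group_add \<Rightarrow> 'v) \<Rightarrow> ('i \<Rightarrow> 'v) \<Rightarrow> ('i \<Rightarrow>\<^sub>0 'k) \<Rightarrow> 'v" where
  "lin_ext sc \<phi> u = (\<Sum>i\<in>Poly_Mapping.keys u. sc (Poly_Mapping.lookup u i) (\<phi> i))"


section \<open>Tensor products\<close>

text \<open>
  \<open>V \<otimes> W\<close> is the quotient of the free vector space on \<open>V \<times> W\<close> by the span of the bilinearity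
  relations, and similarly for three factors.  The relation expressing linearity in one slot is
  written once, for a function \<open>e\<close> that inserts a vector into that slot.
\<close>

definition linearity_rels ::
  "('k::field \<Rightarrow> 'h::ab_group_add \<Rightarrow> 'h) \<Rightarrow> 'h set \<Rightarrow> ('h \<Rightarrow> 'i) \<Rightarrow> ('i \<Rightarrow>\<^sub>0 'k) set" where
  "linearity_rels scale V e =
     {fbasis (e (a + b)) - fbasis (e a) - fbasis (e b) | a b. a \<in> V \<and> b \<in> V} \<union>
     {fbasis (e (scale c a)) - fscale c (fbasis (e a)) | c a. a \<in> V}"

definition tensor_null ::
  "('k::field \<Rightarrow> 'h::ab_group_add \<Rightarrow> 'h) \<Rightarrow> 'h set \<Rightarrow> 'h set \<Rightarrow> ('h \<times> 'h \<Rightarrow>\<^sub>0 'k) set" where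
  "tensor_null scale V W = module.span fscale
     ((\<Union>w\<in>W. linearity_rels scale V (\<lambda>v. (v, w))) \<union>
      (\<Union>v\<in>V. linearity_rels scale W (\<lambda>w. (v, w))))"

definition tensor3_null ::
  "('k::field \<Rightarrow> 'h::ab_group_add \<Rightarrow> 'h) \<Rightarrow> ('h \<times> 'h \<times> 'h \<Rightarrow>\<^sub>0 'k) set" where
  "tensor3_null scale = module.span fscale
     ((\<Union>b c. linearity_rels scale UNIV (\<lambda>a. (a, b, c))) \<union>
      (\<Union>a c. linearity_rels scale UNIV (\<lambda>b. (a, b, c))) \<union>
      (\<Union>a b. linearity_rels scale UNIV (\<lambda>c. (a, b, c))))"

definition formal_sums :: "'i set \<Rightarrow> ('i \<Rightarrow>\<^sub>0 'k::field) set" where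
  "formal_sums A = {u. Poly_Mapping.keys u \<subseteq> A}"

definition tensor_rel ::
  "('k::field \<Rightarrow> 'h::ab_group_add \<Rightarrow> 'h) \<Rightarrow> 'h set \<Rightarrow> 'h set \<Rightarrow>
     (('h \<times> 'h \<Rightarrow>\<^sub>0 'k) \<times> ('h \<times> 'h \<Rightarrow>\<^sub>0 'k)) set" where
  "tensor_rel scale V W =
     {(u, u'). u \<in> formal_sums (V \<times> W) \<and> u' \<in> formal_sums (V \<times> W) \<and> u - u' \<in> tensor_null scale V W}"

definition tensor_product ::
  "('k::field \<Rightarrow> 'h::ab_group_add \<Rightarrow> 'h) \<Rightarrow> 'h set \<Rightarrow> 'h set \<Rightarrow> ('h \<times> 'h \<Rightarrow>\<^sub>0 'k) set set" where
  "tensor_product scale V W = formal_sums (V \<times> W) // tensor_rel scale V W"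

text \<open>Equality in \<open>H \<otimes> H\<close> and in \<open>H \<otimes> H \<otimes> H\<close> of the elements represented by two formal sums.\<close>

definition tensor_eq ::
  "('k::field \<Rightarrow> 'h::ab_group_add \<Rightarrow> 'h) \<Rightarrow> ('h \<times> 'h \<Rightarrow>\<^sub>0 'k) \<Rightarrow> ('h \<times> 'h \<Rightarrow>\<^sub>0 'k) \<Rightarrow> bool" where
  "tensor_eq scale u u' \<longleftrightarrow> u - u' \<in> tensor_null scale UNIV UNIV"

definition tensor3_eq ::
  "('k::field \<Rightarrow> 'h::ab_group_add \<Rightarrow> 'h) \<Rightarrow> ('h \<times> 'h \<times> 'h \<Rightarrow>\<^sub>0 'k) \<Rightarrow> ('h \<times> 'h \<times> 'h \<Rightarrow>\<^sub>0 'k) \<Rightarrow> bool"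
  where "tensor3_eq scale u u' \<longleftrightarrow> u - u' \<in> tensor3_null scale"

definition tensor_mult ::
  "('h::ring_1 \<times> 'h \<Rightarrow>\<^sub>0 'k::field) \<Rightarrow> ('h \<times> 'h \<Rightarrow>\<^sub>0 'k) \<Rightarrow> ('h \<times> 'h \<Rightarrow>\<^sub>0 'k)" where
  "tensor_mult u v =
     lin_ext fscale (\<lambda>(a, b). lin_ext fscale (\<lambda>(c, d). fbasis (a * c, b * d)) v) u"


section \<open>Hopf algebras\<close>

locale k_algebra = vector_space scale
  for scale :: "'k::field \<Rightarrow> 'h::ring_1 \<Rightarrow> 'h" +
  assumes scale_mult_left: "scale c a * b = scale c (a * b)"
    and scale_mult_right: "a * scale c b = scale c (a * b)"

text \<open>
  \<open>\<Delta> h\<close> is a formal sum of pairs representing the coproduct of \<open>h\<close> in \<open>H \<otimes> H\<close> (a choice of Sweedler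
  sum \<open>\<Sum> h\<^sub>1 \<otimes> h\<^sub>2\<close>); only its class matters, so all conditions on \<open>\<Delta>\<close> are stated up to
  \<^const>\<open>tensor_eq\<close>.
\<close>

locale hopf_algebra = k_algebra scale
  for scale :: "'k::field \<Rightarrow> 'h::ring_1 \<Rightarrow> 'h" +
  fixes \<Delta> :: "'h \<Rightarrow> ('h \<times> 'h \<Rightarrow>\<^sub>0 'k)"
    and \<epsilon> :: "'h \<Rightarrow> 'k"
    and S :: "'h \<Rightarrow> 'h"
  assumes comult_add: "tensor_eq scale (\<Delta> (a + b)) (\<Delta> a + \<Delta> b)"
    and comult_scale: "tensor_eq scale (\<Delta> (scale c a)) (fscale c (\<Delta> a))"
    and comult_mult: "tensor_eq scale (\<Delta> (a * b)) (tensor_mult (\<Delta> a) (\<Delta> b))"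
    and comult_one: "tensor_eq scale (\<Delta> 1) (fbasis (1, 1))"
    and coassoc: "tensor3_eq scale
          (lin_ext fscale (\<lambda>(b, c). lin_ext fscale (\<lambda>(b\<^sub>1, b\<^sub>2). fbasis (b\<^sub>1, b\<^sub>2, c)) (\<Delta> b)) (\<Delta> a))
          (lin_ext fscale (\<lambda>(b, c). lin_ext fscale (\<lambda>(c\<^sub>1, c\<^sub>2). fbasis (b, c\<^sub>1, c\<^sub>2)) (\<Delta> c)) (\<Delta> a))"
    and counit_linear: "Vector_Spaces.linear scale (*) \<epsilon>"
    and counit_mult: "\<epsilon> (a * b) = \<epsilon> a * \<epsilon> b"
    and counit_one: "\<epsilon> 1 = 1"
    and counit_left: "lin_ext scale (\<lambda>(b, c). scale (\<epsilon> b) c) (\<Delta> a) = a"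
    and counit_right: "lin_ext scale (\<lambda>(b, c). scale (\<epsilon> c) b) (\<Delta> a) = a"
    and antipode_linear: "Vector_Spaces.linear scale scale S"
    and antipode_left: "lin_ext scale (\<lambda>(b, c). S b * c) (\<Delta> a) = scale (\<epsilon> a) 1"
    and antipode_right: "lin_ext scale (\<lambda>(b, c). b * S c) (\<Delta> a) = scale (\<epsilon> a) 1"

definition hopf_subalgebra ::
  "('k::field \<Rightarrow> 'h::ring_1 \<Rightarrow> 'h) \<Rightarrow> ('h \<Rightarrow> ('h \<times> 'h \<Rightarrow>\<^sub>0 'k)) \<Rightarrow> ('h \<Rightarrow> 'h) \<Rightarrow> 'h set \<Rightarrow> bool" where
  "hopf_subalgebra scale \<Delta> S B \<longleftrightarrow>
     module.subspace scale B \<and> 1 \<in> B \<and> (\<forall>a\<in>B. \<forall>b\<in>B. a * b \<in> B) \<and>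
     (\<forall>b\<in>B. \<exists>u\<in>formal_sums (B \<times> B). tensor_eq scale (\<Delta> b) u) \<and>
     (\<forall>b\<in>B. S b \<in> B)"

definition hopf_generated ::
  "('k::field \<Rightarrow> 'h::ring_1 \<Rightarrow> 'h) \<Rightarrow> ('h \<Rightarrow> ('h \<times> 'h \<Rightarrow>\<^sub>0 'k)) \<Rightarrow> ('h \<Rightarrow> 'h) \<Rightarrow> 'h set \<Rightarrow> 'h set" where
  "hopf_generated scale \<Delta> S A = \<Inter>{B. hopf_subalgebra scale \<Delta> S B \<and> A \<subseteq> B}"

text \<open>
  The multiplication map on \<open>B \<otimes> T\<close>.  Evaluation of formal sums is constant on each class, so the
  image of a class is a singleton.
\<close>

definition mult_map ::
  "('k::field \<Rightarrow> 'h::ring_1 \<Rightarrow> 'h) \<Rightarrow> ('h \<times> 'h \<Rightarrow>\<^sub>0 'k) set \<Rightarrow> 'h" where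
  "mult_map scale U = the_elem (lin_ext scale (\<lambda>(b, t). b * t) ` U)"

definition exact_factorization ::
  "('k::field \<Rightarrow> 'h::ring_1 \<Rightarrow> 'h) \<Rightarrow> 'h set \<Rightarrow> 'h set \<Rightarrow> bool" where
  "exact_factorization scale B T \<longleftrightarrow> bij_betw (mult_map scale) (tensor_product scale B T) UNIV"

definition proper_exact_factorizations ::
  "('k::field \<Rightarrow> 'h::ring_1 \<Rightarrow> 'h) \<Rightarrow> ('h \<Rightarrow> ('h \<times> 'h \<Rightarrow>\<^sub>0 'k)) \<Rightarrow> ('h \<Rightarrow> 'h) \<Rightarrow>
     ('h set \<times> 'h set) set" where
  "proper_exact_factorizations scale \<Delta> S =
     {(B, T). hopf_subalgebra scale \<Delta> S B \<and> B \<noteq> UNIV \<and>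
              hopf_subalgebra scale \<Delta> S T \<and> T \<noteq> UNIV \<and> exact_factorization scale B T}"


section \<open>Presentations of algebras\<close>

text \<open>
  The free algebra on a set \<open>Y\<close> of generators has the words over \<open>Y\<close> as a basis.  The two-sided ideal
  generated by \<open>R\<close> is the span of all \<open>u r v\<close> with \<open>r \<in> R\<close> and words \<open>u\<close>, \<open>v\<close>.
\<close>

definition ideal_generated ::
  "'y set \<Rightarrow> ('y list \<Rightarrow>\<^sub>0 'k::field) set \<Rightarrow> ('y list \<Rightarrow>\<^sub>0 'k) set" where
  "ideal_generated Y R = module.span fscale
     {lin_ext fscale (\<lambda>w. fbasis (u @ w @ v)) r | u v r. u \<in> lists Y \<and> v \<in> lists Y \<and> r \<in> R}"

definition word_eval ::
  "('k::field \<Rightarrow> 'h::ring_1 \<Rightarrow> 'h) \<Rightarrow> ('y \<Rightarrow> 'h) \<Rightarrow> ('y list \<Rightarrow>\<^sub>0 'k) \<Rightarrow> 'h" where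
  "word_eval scale \<xi> = lin_ext scale (\<lambda>w. prod_list (map \<xi> w))"

definition presented_by ::
  "('k::field \<Rightarrow> 'h::ring_1 \<Rightarrow> 'h) \<Rightarrow> 'y set \<Rightarrow> ('y \<Rightarrow> 'h) \<Rightarrow> ('y list \<Rightarrow>\<^sub>0 'k) set \<Rightarrow> bool" where
  "presented_by scale Y \<xi> R \<longleftrightarrow>
     word_eval scale \<xi> ` formal_sums (lists Y) = UNIV \<and>
     {u \<in> formal_sums (lists Y). word_eval scale \<xi> u = 0} = ideal_generated Y R"


section \<open>The Hopf algebras of the third type\<close>

text \<open>The last condition is an identity in the group algebra \<open>k[G]\<close>, realized as \<open>'g \<Rightarrow>\<^sub>0 'k\<close>.\<close>

definition third_type_datum ::
  "('g, 'm) monoid_scheme \<Rightarrow> 'g \<Rightarrow> ('g \<Rightarrow> 'k::field) \<Rightarrow> bool" where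
  "third_type_datum G g f \<longleftrightarrow>
     group G \<and> finite (carrier G) \<and>
     g \<in> carrier G \<and> (\<forall>t\<in>carrier G. t \<otimes>\<^bsub>G\<^esub> g = g \<otimes>\<^bsub>G\<^esub> t) \<and>
     (\<forall>s\<in>carrier G. \<forall>t\<in>carrier G. f (s \<otimes>\<^bsub>G\<^esub> t) = f s + f t) \<and> f g = 1 \<and>
     (\<forall>t\<in>carrier G.
        fscale (f t ^ CHAR('k) - f t)
          (fbasis \<one>\<^bsub>G\<^esub> - fbasis (g [^]\<^bsub>G\<^esub> CHAR('k))) = 0)"

datatype 'g gen = GenG 'g | GenX

definition third_type_gens :: "('g, 'm) monoid_scheme \<Rightarrow> 'g gen set" where
  "third_type_gens G = insert GenX (GenG ` carrier G)"

text \<open>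
  The first two families of relations present the group algebra \<open>k[G]\<close>; the others are
  \<open>t x - x t = f(t) t (1 - g)\<close> and \<open>x\<^sup>p = x\<close>.
\<close>

definition third_type_rels ::
  "('g, 'm) monoid_scheme \<Rightarrow> 'g \<Rightarrow> ('g \<Rightarrow> 'k::field) \<Rightarrow> ('g gen list \<Rightarrow>\<^sub>0 'k) set" where
  "third_type_rels G g f =
     {fbasis [GenG s, GenG t] - fbasis [GenG (s \<otimes>\<^bsub>G\<^esub> t)] | s t. s \<in> carrier G \<and> t \<in> carrier G} \<union>
     {fbasis [GenG \<one>\<^bsub>G\<^esub>] - fbasis []} \<union>
     {fbasis [GenG t, GenX] - fbasis [GenX, GenG t]
        - fscale (f t) (fbasis [GenG t] - fbasis [GenG t, GenG g]) | t. t \<in> carrier G} \<union>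
     {fbasis (replicate CHAR('k) GenX) - fbasis [GenX]}"

text \<open>
  A Hopf algebra \<open>H\<close> (the whole type \<open>'h\<close>) with a map \<open>\<iota>\<close> from \<open>G\<close> and an element \<open>x\<close> that identify it
  with \<open>\<AA>\<^sup>3\<^sub>G(g, f)\<close>.
\<close>

locale third_type_hopf_algebra = hopf_algebra scale \<Delta> \<epsilon> S
  for scale :: "'k::field \<Rightarrow> 'h::ring_1 \<Rightarrow> 'h" and \<Delta> \<epsilon> S +
  fixes G :: "('g, 'm) monoid_scheme" and g :: 'g and f :: "'g \<Rightarrow> 'k"
    and \<iota> :: "'g \<Rightarrow> 'h" and x :: 'h
  assumes presentation:
      "presented_by scale (third_type_gens G) (case_gen \<iota> x) (third_type_rels G g f)"
    and comult_grp: "t \<in> carrier G \<Longrightarrow> tensor_eq scale (\<Delta> (\<iota> t)) (fbasis (\<iota> t, \<iota> t))"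
    and counit_grp: "t \<in> carrier G \<Longrightarrow> \<epsilon> (\<iota> t) = 1"
    and antipode_grp: "t \<in> carrier G \<Longrightarrow> S (\<iota> t) = \<iota> (inv\<^bsub>G\<^esub> t)"
    and comult_x: "tensor_eq scale (\<Delta> x) (fbasis (x, 1) + fbasis (\<iota> g, x))"
    and counit_x: "\<epsilon> x = 0"
    and antipode_x: "S x = - (\<iota> (inv\<^bsub>G\<^esub> g) * x)"

text \<open>
  For a subgroup \<open>G\<^sub>B\<close> containing \<open>g\<close>, the Hopf algebra \<open>\<AA>\<^sup>3(g, f|G\<^sub>B)\<close> of \<open>G\<^sub>B\<close> is identified
  with the Hopf subalgebra of \<open>H\<close> generated by \<open>G\<^sub>B\<close> and \<open>x\<close>.
\<close>

definition third_type_sub ::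
  "('k::field \<Rightarrow> 'h::ring_1 \<Rightarrow> 'h) \<Rightarrow> ('h \<Rightarrow> ('h \<times> 'h \<Rightarrow>\<^sub>0 'k)) \<Rightarrow> ('h \<Rightarrow> 'h) \<Rightarrow>
     ('g \<Rightarrow> 'h) \<Rightarrow> 'h \<Rightarrow> 'g set \<Rightarrow> 'h set" where
  "third_type_sub scale \<Delta> S \<iota> x G\<^sub>B = hopf_generated scale \<Delta> S (insert x (\<iota> ` G\<^sub>B))"

definition group_algebra_sub ::
  "('k::field \<Rightarrow> 'h::ring_1 \<Rightarrow> 'h) \<Rightarrow> ('g \<Rightarrow> 'h) \<Rightarrow> 'g set \<Rightarrow> 'h set" where
  "group_algebra_sub scale \<iota> \<Gamma> = module.span scale (\<iota> ` \<Gamma>)"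

definition group_exact_factorizations ::
  "('g, 'm) monoid_scheme \<Rightarrow> 'g \<Rightarrow> ('g set \<times> 'g set) set" where
  "group_exact_factorizations G g =
     {(G\<^sub>B, \<Gamma>). subgroup G\<^sub>B G \<and> subgroup \<Gamma> G \<and> carrier G = G\<^sub>B <#>\<^bsub>G\<^esub> \<Gamma> \<and>
              G\<^sub>B \<inter> \<Gamma> = {\<one>\<^bsub>G\<^esub>} \<and> g \<in> G\<^sub>B \<and> \<Gamma> \<noteq> {\<one>\<^bsub>G\<^esub>}}"

end

theory Submission
  imports Defs
begin

text \<open>
  The proof is linear algebra in the basis \<open>x\<^sup>i t\<close> (\<open>i < p\<close>, \<open>t \<in> G\<close>) of \<open>H\<close>.

  That these elements span is immediate from the relations.  For their independence, every
  \<open>l \<in> \<F>\<^sub>p\<close> gives a module structure on the functions \<open>G \<rightarrow> k\<close>: the group acts by translation and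
  \<open>x\<close> by \<open>(x \<cdot> \<phi>)(r) = (f r + l) \<phi>(r) - f r \<phi>(r g)\<close>.  The only relation that is not obvious is
  \<open>x\<^sup>p = x\<close>; it holds because \<open>X\<^sup>p - X\<close> minus a constant is a product of linear factors along which
  the action of \<open>x\<close> telescopes (\<open>weighted_shift_power_CHAR\<close>), and this is where the identity
  \<open>(f(t)\<^sup>p - f(t)) (1 - g\<^sup>p) = 0\<close> of the datum enters.  Evaluating at \<open>1\<close> turns a linear relation among
  the \<open>x\<^sup>i t\<close> into polynomials of degree less than \<open>p\<close> with the \<open>p\<close> roots \<open>l \<in> \<F>\<^sub>p\<close>
  (\<open>basis_independent\<close>).

  A Hopf subalgebra \<open>C\<close> is stable under slicing, that is, under \<open>(\<alpha> \<otimes> id) \<Delta>\<close> and \<open>(id \<otimes> \<alpha>) \<Delta>\<close> for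
  every linear functional \<open>\<alpha>\<close>.  Slicing with suitable coordinate functionals projects an element of
  \<open>C\<close> to the part supported on a single \<open>t\<close>, extracts from this part the group element \<open>t\<close>, and,
  if \<open>x\<close> occurs in it, extracts \<open>x\<close> itself (\<open>iota_in_hopf_subalgebra\<close>).  So \<open>C\<close> is either a group
  algebra \<open>k[\<Gamma>]\<close> or the span of all \<open>x\<^sup>i t\<close> with \<open>t\<close> in a subgroup that contains \<open>g\<close>
  (\<open>hopf_subalgebra_classification\<close>), and both kinds occur (\<open>hopf_subalgebra_filt\<close>,
  \<open>hopf_subalgebra_filt_1\<close>).

  In an exact factorization \<open>H = BT\<close> the multiplication map is injective, so \<open>B \<inter> T\<close> contains no
  \<open>h\<close> independent of \<open>1\<close>: at most one factor contains \<open>x\<close>, and the two groups meet trivially.  It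
  is surjective, so some factor contains \<open>x\<close> and the product of the two groups is \<open>G\<close>
  (\<open>exact_factorization_cases\<close>).  Conversely, if \<open>G = K \<Gamma>\<close> exactly, then multiplication sends the
  basis elements \<open>x\<^sup>i u \<otimes> c\<close> with \<open>u \<in> K\<close> and \<open>c \<in> \<Gamma>\<close> bijectively to the basis elements \<open>x\<^sup>i (u c)\<close>
  of \<open>H\<close> (\<open>exact_factorization_filt\<close>).
\<close>

section \<open>An operator identity in characteristic \<open>p\<close>\<close>

lemma of_nat_power_CHAR:
  assumes "prime CHAR('k::field)"
  shows "(of_nat n :: 'k) ^ CHAR('k) = of_nat n"
proof (induction n)
  case 0
  then show ?case using prime_gt_0_nat[OF assms] by (simp add: zero_power)
next
  case (Suc n)
  then show ?case
    using freshmans_dream[OF assms refl, of "of_nat n" 1] by (simp add: add.commute)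
qed

lemma inj_on_of_nat_CHAR: "inj_on (of_nat :: nat \<Rightarrow> 'k::field) {..<CHAR('k)}"
proof (rule linorder_inj_onI)
  fix a b assume ab: "a < b" "a \<in> {..<CHAR('k)}" "b \<in> {..<CHAR('k)}"
  show "(of_nat a :: 'k) \<noteq> of_nat b"
  proof
    assume "(of_nat a :: 'k) = of_nat b"
    then have "(of_nat (b - a) :: 'k) = 0" using ab by (simp add: of_nat_diff)
    then have "CHAR('k) dvd b - a" by (simp add: of_nat_eq_0_iff_char_dvd)
    then show False using ab by (auto dest: dvd_imp_le)
  qed
qed auto

text \<open>
  Both sides are monic of degree \<open>p\<close>, and \<open>p\<close> elements \<open>e + j\<close> are common roots because \<open>z \<mapsto> z\<^sup>p\<close> is
  additive and fixes the prime field.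
\<close>

lemma prod_prime_field_translates:
  fixes e :: "'k::field"
  assumes p: "prime CHAR('k)"
  shows "(\<Prod>j<CHAR('k). [:- (e + of_nat j), 1:])
     = monom 1 CHAR('k) - monom 1 1 - [:e ^ CHAR('k) - e:]" (is "?P = ?Q")
proof (rule poly_eqI_degree_lead_coeff[where n = "CHAR('k)" and A = "(\<lambda>j. e + of_nat j) ` {..<CHAR('k)}"])
  have p1: "1 < CHAR('k)" using p by (rule prime_gt_1_nat)
  have deg: "degree ?P = CHAR('k)"
    by (subst degree_prod_eq_sum_degree) auto
  have "lead_coeff ?P = 1" by (simp add: lead_coeff_prod)
  then have "coeff ?P CHAR('k) = 1" using deg by simp
  moreover have "coeff ?Q CHAR('k) = 1" using p1 by (cases "CHAR('k)") (auto simp: coeff_pCons)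
  ultimately show "coeff ?P CHAR('k) = coeff ?Q CHAR('k)" by simp
  show "degree ?P \<le> CHAR('k)" using deg by simp
  show "degree ?Q \<le> CHAR('k)"
    using p1 by (intro degree_diff_le degree_monom_le[THEN order_trans]) auto
  have "inj_on (\<lambda>j. e + of_nat j) {..<CHAR('k)}"
    using inj_on_of_nat_CHAR[where 'k = 'k] by (auto simp: inj_on_def)
  then show "CHAR('k) \<le> card ((\<lambda>j. e + of_nat j) ` {..<CHAR('k)})"
    by (simp add: card_image)
  fix z assume "z \<in> (\<lambda>j. e + of_nat j) ` {..<CHAR('k)}"
  then obtain j where j: "j < CHAR('k)" "z = e + of_nat j" by auto
  have "poly ?P z = 0" using j by (auto simp: poly_prod intro!: prod_zero)
  moreover have "poly ?Q z = 0"
    using freshmans_dream[OF p refl, of e "of_nat j"] of_nat_power_CHAR[OF p, of j]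
    by (simp add: j poly_monom)
  ultimately show "poly ?P z = poly ?Q z" by simp
qed

definition poly_op :: "((nat \<Rightarrow> 'k) \<Rightarrow> nat \<Rightarrow> 'k) \<Rightarrow> 'k::field poly \<Rightarrow> (nat \<Rightarrow> 'k) \<Rightarrow> nat \<Rightarrow> 'k" where
  "poly_op T q a n = (\<Sum>i\<le>degree q. coeff q i * (T ^^ i) a n)"

lemma poly_op_bound:
  assumes "degree q \<le> N"
  shows "poly_op T q a n = (\<Sum>i\<le>N. coeff q i * (T ^^ i) a n)"
  unfolding poly_op_def using assms
  by (intro sum.mono_neutral_left) (auto simp: coeff_eq_0)

text \<open>
  The action of \<open>x\<close> along a coset \<open>r\<langle>g\<rangle>\<close>: here \<open>c = f r\<close> and the sequence is \<open>n \<mapsto> \<phi>(r g\<^sup>n)\<close>, so that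
  \<open>f (r g\<^sup>n) = c + n\<close>.
\<close>

definition weighted_shift :: "'k::field \<Rightarrow> 'k \<Rightarrow> (nat \<Rightarrow> 'k) \<Rightarrow> nat \<Rightarrow> 'k" where
  "weighted_shift c l a n = (c + l + of_nat n) * a n - (c + of_nat n) * a (Suc n)"

lemma poly_op_linear_factor:
  "poly_op (weighted_shift c l) ([:- e, 1:] * q) a n
     = weighted_shift c l (poly_op (weighted_shift c l) q a) n - e * poly_op (weighted_shift c l) q a n"
proof -
  let ?T = "weighted_shift c l"
  define d where "d = degree q"
  have "degree ([:- e, 1:] * q) \<le> Suc d"
    using degree_mult_le[of "[:- e, 1:]" q] by (simp add: d_def)
  then have "poly_op ?T ([:- e, 1:] * q) a n = (\<Sum>i\<le>Suc d. coeff ([:- e, 1:] * q) i * (?T ^^ i) a n)"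
    by (rule poly_op_bound)
  also have "\<dots> = (\<Sum>i\<le>Suc d. coeff (pCons 0 q) i * (?T ^^ i) a n)
      - e * (\<Sum>i\<le>Suc d. coeff q i * (?T ^^ i) a n)"
    by (simp add: sum_distrib_left sum_subtractf[symmetric] algebra_simps del: sum.atMost_Suc)
  also have "(\<Sum>i\<le>Suc d. coeff q i * (?T ^^ i) a n) = poly_op ?T q a n"
    by (rule poly_op_bound[symmetric]) (simp add: d_def)
  also have "(\<Sum>i\<le>Suc d. coeff (pCons 0 q) i * (?T ^^ i) a n) = ?T (poly_op ?T q a) n"
    unfolding sum.atMost_Suc_shift
    by (simp add: poly_op_def d_def[symmetric] weighted_shift_def sum_distrib_left
        right_diff_distrib sum_subtractf mult.left_commute)
  finally show ?thesis .
qed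

text \<open>
  The factor \<open>T - (c + l + m)\<close> annihilates the diagonal coefficient at the position \<open>m\<close>.  Evaluated
  at \<open>0\<close>, the product of these factors over \<open>m < p\<close> therefore moves one position to the right with
  each factor and leaves a multiple of \<open>a p\<close>.  The same product is \<open>T\<^sup>p - T\<close> minus the scalar
  \<open>(c + l)\<^sup>p - (c + l) = c\<^sup>p - c\<close>; comparing the two gives the claim.
\<close>

lemma weighted_shift_power_CHAR:
  fixes c l :: "'k::field"
  assumes p: "prime CHAR('k)" and l: "l ^ CHAR('k) = l"
    and ac: "(c ^ CHAR('k) - c) * (a 0 - a CHAR('k)) = 0"
  shows "(weighted_shift c l ^^ CHAR('k)) a 0 = weighted_shift c l a 0"
proof -
  let ?p = "CHAR('k)" and ?T = "weighted_shift c l"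
  let ?P = "\<lambda>e m. \<Prod>j=m..<CHAR('k). [:- (e + of_nat j), 1:]"
  have p1: "1 < ?p" using p by (rule prime_gt_1_nat)
  \<comment> \<open>The partial product of the factors from \<open>m\<close> on, evaluated at \<open>m\<close>, has moved \<open>p - m\<close> steps.\<close>
  have tele: "poly_op ?T (?P (c + l) m) a m = (\<Prod>j=m..<?p. - (c + of_nat j)) * a ?p"
    if "m \<le> ?p" for m
    using that
  proof (induction rule: inc_induct)
    case base
    then show ?case by (simp add: poly_op_def)
  next
    case (step m)
    have "?P (c + l) m = [:- (c + l + of_nat m), 1:] * ?P (c + l) (Suc m)"
      using step.hyps by (intro prod.atLeast_Suc_lessThan) auto
    then have "poly_op ?T (?P (c + l) m) a m = - (c + of_nat m) * poly_op ?T (?P (c + l) (Suc m)) a (Suc m)"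
      by (simp only: poly_op_linear_factor) (simp (no_asm) add: weighted_shift_def algebra_simps)
    also have "\<dots> = (\<Prod>j=m..<?p. - (c + of_nat j)) * a ?p"
      using step by (subst (2) prod.atLeast_Suc_lessThan) auto
    finally show ?case .
  qed
  have translates: "?P e 0 = monom 1 ?p - monom 1 1 - [:e ^ ?p - e:]" for e :: 'k
    using prod_prime_field_translates[OF p, of e] by (simp add: atLeast0LessThan)
  \<comment> \<open>The product of the off-diagonal coefficients is the value at \<open>0\<close> of the same polynomial for \<open>e = c\<close>.\<close>
  have "poly (?P c 0) 0 = (\<Prod>j=0..<?p. - (c + of_nat j))"
    by (simp add: poly_prod)
  then have const: "(\<Prod>j=0..<?p. - (c + of_nat j)) = c - c ^ ?p"
    unfolding translates using p1 by (simp add: poly_monom power_0_left)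
  let ?Q = "monom 1 ?p - monom 1 1 - [:(c + l) ^ ?p - (c + l):]"
  have deg: "degree ?Q \<le> ?p"
    using p1 by (intro degree_diff_le degree_monom_le[THEN order_trans]) auto
  have split: "coeff ?Q i = (if i = ?p then 1 else 0) - (if i = 1 then 1 else 0)
      - (if i = 0 then c ^ ?p - c else 0)" for i
    using freshmans_dream[OF p refl, of c l] l p1 by (auto simp: coeff_pCons split: nat.split)
  have "poly_op ?T ?Q a 0 = (?T ^^ ?p) a 0 - ?T a 0 - (c ^ ?p - c) * a 0"
    unfolding poly_op_bound[OF deg] split using p1
    by (simp add: left_diff_distrib sum_subtractf if_distrib[of "\<lambda>y. y * _"] cong: if_cong)
  moreover have "poly_op ?T ?Q a 0 = (c - c ^ ?p) * a ?p"
    using tele[of 0] unfolding translates const by simp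
  moreover have "y - z = (d - c) * (s - t)" if "q = y - z - (d - c) * s" "q = (c - d) * t"
    for q y z d s t :: 'k
    using that by (simp add: eq_diff_eq right_diff_distrib left_diff_distrib) (simp add: algebra_simps)
  ultimately have "(?T ^^ ?p) a 0 - ?T a 0 = (c ^ ?p - c) * (a 0 - a ?p)"
    by blast
  then show ?thesis using ac by simp
qed

section \<open>Formal sums and tensors\<close>

interpretation fsum: vector_space fscale
  by (rule vector_space_fscale)

lemma fbasis_eq_iff [simp]: "fbasis i = (fbasis j :: 'i \<Rightarrow>\<^sub>0 'k::field) \<longleftrightarrow> i = j"
  unfolding fbasis_def by (metis lookup_single_eq lookup_single_not_eq one_neq_zero)

context vector_space
begin

lemma lin_ext_superset:
  assumes "finite A" "Poly_Mapping.keys u \<subseteq> A"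
  shows "lin_ext scale \<phi> u = (\<Sum>i\<in>A. scale (Poly_Mapping.lookup u i) (\<phi> i))"
  unfolding lin_ext_def using assms
  by (intro sum.mono_neutral_left) (auto simp: in_keys_iff)

lemma lin_ext_fbasis [simp]: "lin_ext scale \<phi> (fbasis i) = \<phi> i"
  by (simp add: lin_ext_def fbasis_def)

lemma lin_ext_zero [simp]: "lin_ext scale \<phi> 0 = 0"
  by (simp add: lin_ext_def)

lemma lin_ext_add: "lin_ext scale \<phi> (u + v) = lin_ext scale \<phi> u + lin_ext scale \<phi> v"
proof -
  let ?A = "Poly_Mapping.keys u \<union> Poly_Mapping.keys v"
  have "Poly_Mapping.keys (u + v) \<subseteq> ?A" by (rule Poly_Mapping.keys_add)
  then show ?thesis
    by (simp add: lin_ext_superset[of ?A] lookup_add scale_left_distrib sum.distrib)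
qed

lemma lin_ext_fscale: "lin_ext scale \<phi> (fscale c u) = scale c (lin_ext scale \<phi> u)"
proof -
  have "Poly_Mapping.keys (fscale c u) \<subseteq> Poly_Mapping.keys u"
    by (auto simp: in_keys_iff lookup_fscale)
  then show ?thesis
    by (simp add: lin_ext_superset[of "Poly_Mapping.keys u"] lookup_fscale scale_sum_right)
qed

lemma lin_ext_linear: "Vector_Spaces.linear fscale scale (lin_ext scale \<phi>)"
  by (intro Vector_Spaces.linear_iff[THEN iffD2] conjI allI lin_ext_add lin_ext_fscale
      vector_space_fscale vector_space_axioms)

lemma lin_ext_diff: "lin_ext scale \<phi> (u - v) = lin_ext scale \<phi> u - lin_ext scale \<phi> v"
  by (rule module_hom.diff[OF module_hom_iff_linear[THEN iffD2, OF lin_ext_linear]])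

lemma lin_ext_sum: "lin_ext scale \<phi> (sum u A) = (\<Sum>i\<in>A. lin_ext scale \<phi> (u i))"
  by (rule module_hom.sum[OF module_hom_iff_linear[THEN iffD2, OF lin_ext_linear]])

lemma lin_ext_in_subspace:
  assumes "subspace N" "\<And>i. i \<in> Poly_Mapping.keys u \<Longrightarrow> \<phi> i \<in> N"
  shows "lin_ext scale \<phi> u \<in> N"
  unfolding lin_ext_def using assms by (intro subspace_sum subspace_scale)

lemma lin_ext_function_diff:
  "lin_ext scale \<phi> u - lin_ext scale \<psi> u = lin_ext scale (\<lambda>i. \<phi> i - \<psi> i) u"
  by (simp add: lin_ext_def sum_subtractf scale_right_diff_distrib)

lemma lin_ext_function_scale:
  "scale c (lin_ext scale \<phi> u) = lin_ext scale (\<lambda>i. scale c (\<phi> i)) u"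
  by (simp add: lin_ext_def scale_sum_right mult.commute)

end

lemma linear_lin_ext:
  assumes "Vector_Spaces.linear s t h"
  shows "h (lin_ext s \<phi> u) = lin_ext t (\<lambda>i. h (\<phi> i)) u"
proof -
  interpret Vector_Spaces.linear s t h by fact
  show ?thesis by (simp add: lin_ext_def sum scale)
qed

lemma lin_ext_fbasis_self: "lin_ext fscale fbasis u = u"
proof (rule poly_mapping_eqI)
  fix j
  have "Poly_Mapping.lookup (lin_ext fscale fbasis u) j
      = (\<Sum>i\<in>Poly_Mapping.keys u. Poly_Mapping.lookup u i * (if i = j then 1 else 0))"
    by (simp add: lin_ext_def lookup_sum lookup_fscale fbasis_def lookup_single when_def)
  also have "\<dots> = Poly_Mapping.lookup u j"
    by (simp add: if_distrib[of "\<lambda>y. _ * y"] in_keys_iff cong: if_cong)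
  finally show "Poly_Mapping.lookup (lin_ext fscale fbasis u) j = Poly_Mapping.lookup u j" .
qed

lemma formal_sums_eq_span: "formal_sums A = fsum.span (fbasis ` A)"
proof
  show "formal_sums A \<subseteq> fsum.span (fbasis ` A)"
  proof
    fix u assume "u \<in> formal_sums A"
    then have "lin_ext fscale fbasis u \<in> fsum.span (fbasis ` A)"
      by (intro fsum.lin_ext_in_subspace fsum.subspace_span fsum.span_base)
        (auto simp: formal_sums_def)
    then show "u \<in> fsum.span (fbasis ` A)" by (simp add: lin_ext_fbasis_self)
  qed
  have "fsum.subspace (formal_sums A)"
    unfolding fsum.subspace_def formal_sums_def
    by (auto simp: in_keys_iff lookup_add lookup_fscale subset_iff) (metis add.right_neutral)
  then show "fsum.span (fbasis ` A) \<subseteq> formal_sums A"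
    by (intro fsum.span_minimal) (auto simp: formal_sums_def fbasis_def)
qed

lemma subspace_formal_sums: "fsum.subspace (formal_sums A)"
  by (simp add: formal_sums_eq_span)

lemma fbasis_in_formal_sums: "a \<in> A \<Longrightarrow> fbasis a \<in> formal_sums A"
  by (simp add: formal_sums_def fbasis_def)

lemma formal_sums_mono: "A \<subseteq> B \<Longrightarrow> formal_sums A \<subseteq> formal_sums B"
  by (auto simp: formal_sums_def)

text \<open>
  With \<open>N = {0}\<close> this is bilinearity.  Taking \<open>tensor_null\<close> for \<open>N\<close> covers maps into a tensor product,
  whose elements are represented by formal sums.
\<close>

definition bilinear_mod ::
  "('k::field \<Rightarrow> 'h::ab_group_add \<Rightarrow> 'h) \<Rightarrow> ('k \<Rightarrow> 'v::ab_group_add \<Rightarrow> 'v) \<Rightarrow> 'v set \<Rightarrow> ('h \<Rightarrow> 'h \<Rightarrow> 'v) \<Rightarrow> bool" where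
  "bilinear_mod s t N \<beta> \<longleftrightarrow>
     (\<forall>a a' b. \<beta> (a + a') b - \<beta> a b - \<beta> a' b \<in> N) \<and> (\<forall>c a b. \<beta> (s c a) b - t c (\<beta> a b) \<in> N) \<and>
     (\<forall>a b b'. \<beta> a (b + b') - \<beta> a b - \<beta> a b' \<in> N) \<and> (\<forall>c a b. \<beta> a (s c b) - t c (\<beta> a b) \<in> N)"

text \<open>
  The universal property of the tensor product: a bilinear map is the same as a linear map on formal
  sums that respects the bilinearity relations.
\<close>

lemma bilinear_mod_tensor_null:
  assumes t: "vector_space t" and N: "module.subspace t N" and \<beta>: "bilinear_mod s t N \<beta>"
    and u: "u \<in> tensor_null s V W"
  shows "lin_ext t (\<lambda>(a, b). \<beta> a b) u \<in> N"
proof -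
  interpret t: vector_space t by fact
  show ?thesis
    using u unfolding tensor_null_def
  proof (induction rule: fsum.span_induct_alt)
    case base
    then show ?case using t.subspace_0[OF N] by simp
  next
    case (step c r u)
    have "lin_ext t (\<lambda>(a, b). \<beta> a b) r \<in> N"
      using step.hyps \<beta> unfolding linearity_rels_def bilinear_mod_def
      by (auto simp: t.lin_ext_diff t.lin_ext_fscale)
    then show ?case
      using step.IH by (auto simp: t.lin_ext_add t.lin_ext_fscale intro: t.subspace_add t.subspace_scale N)
  qed
qed

lemma bilinear_tensor_eq:
  assumes t: "vector_space t" and \<beta>: "bilinear_mod s t {0} \<beta>" and u: "tensor_eq s u u'"
  shows "lin_ext t (\<lambda>(a, b). \<beta> a b) u = lin_ext t (\<lambda>(a, b). \<beta> a b) u'"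
proof -
  interpret t: vector_space t by fact
  have "lin_ext t (\<lambda>(a, b). \<beta> a b) (u - u') \<in> {0}"
    using u by (intro bilinear_mod_tensor_null[OF t _ \<beta>]) (auto simp: tensor_eq_def)
  then show ?thesis by (simp add: t.lin_ext_diff)
qed

lemma linearity_rels_tensor_null:
  "w \<in> W \<Longrightarrow> linearity_rels s V (\<lambda>v. (v, w)) \<subseteq> tensor_null s V W"
  "v \<in> V \<Longrightarrow> linearity_rels s W (\<lambda>w. (v, w)) \<subseteq> tensor_null s V W"
  unfolding tensor_null_def by (intro order_trans[OF _ fsum.span_superset]; blast)+

lemma tensor_null_rels:
  "a \<in> V \<Longrightarrow> a' \<in> V \<Longrightarrow> b \<in> W \<Longrightarrow> fbasis (a + a', b) - fbasis (a, b) - fbasis (a', b) \<in> tensor_null s V W"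
  "a \<in> V \<Longrightarrow> b \<in> W \<Longrightarrow> fbasis (s c a, b) - fscale c (fbasis (a, b)) \<in> tensor_null s V W"
  "a \<in> V \<Longrightarrow> b \<in> W \<Longrightarrow> b' \<in> W \<Longrightarrow> fbasis (a, b + b') - fbasis (a, b) - fbasis (a, b') \<in> tensor_null s V W"
  "a \<in> V \<Longrightarrow> b \<in> W \<Longrightarrow> fbasis (a, s c b) - fscale c (fbasis (a, b)) \<in> tensor_null s V W"
  by (rule subsetD[OF linearity_rels_tensor_null(1)], assumption, unfold linearity_rels_def, blast)
    (rule subsetD[OF linearity_rels_tensor_null(1)], assumption, unfold linearity_rels_def, blast,
     (rule subsetD[OF linearity_rels_tensor_null(2)], assumption, unfold linearity_rels_def, blast)+)

lemma bilinear_mod_fbasis: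
  "bilinear_mod s fscale (tensor_null s UNIV UNIV) (\<lambda>a b. fbasis (a, b))"
  by (simp add: bilinear_mod_def tensor_null_rels)

lemma subspace_tensor_null: "fsum.subspace (tensor_null s V W)"
  by (simp add: tensor_null_def)

text \<open>
  Left multiplication by \<open>a \<otimes> b\<close>.
\<close>

definition tensor_lmult :: "'h::ring_1 \<Rightarrow> 'h \<Rightarrow> ('h \<times> 'h \<Rightarrow>\<^sub>0 'k::field) \<Rightarrow> ('h \<times> 'h \<Rightarrow>\<^sub>0 'k)" where
  "tensor_lmult a b v = lin_ext fscale (\<lambda>(c, d). fbasis (a * c, b * d)) v"

lemma tensor_lmult_diff: "tensor_lmult a b (v - v') = tensor_lmult a b v - tensor_lmult a b v'"
  by (simp add: tensor_lmult_def fsum.lin_ext_diff)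

context k_algebra
begin

lemma tensor_eq_refl [simp]: "tensor_eq scale u u"
  by (simp add: tensor_eq_def fsum.subspace_0[OF subspace_tensor_null])

lemma tensor_eq_trans [trans]: "tensor_eq scale u v \<Longrightarrow> tensor_eq scale v w \<Longrightarrow> tensor_eq scale u w"
  using fsum.subspace_add[OF subspace_tensor_null] by (fastforce simp: tensor_eq_def)

lemma tensor_eq_add:
  "tensor_eq scale u u' \<Longrightarrow> tensor_eq scale v v' \<Longrightarrow> tensor_eq scale (u + v) (u' + v')"
  using fsum.subspace_add[OF subspace_tensor_null, of "u - u'" scale _ _ "v - v'"]
  by (simp add: tensor_eq_def algebra_simps)

lemma tensor_eq_fscale: "tensor_eq scale u u' \<Longrightarrow> tensor_eq scale (fscale c u) (fscale c u')"
  using fsum.subspace_scale[OF subspace_tensor_null, of "u - u'" scale _ _ c]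
  by (simp add: tensor_eq_def fsum.scale_right_diff_distrib)

lemma tensor_lmult_null:
  assumes "v \<in> tensor_null scale UNIV UNIV"
  shows "tensor_lmult a b v \<in> tensor_null scale UNIV UNIV"
  unfolding tensor_lmult_def
proof (rule bilinear_mod_tensor_null[OF vector_space_fscale subspace_tensor_null _ assms])
  show "bilinear_mod scale fscale (tensor_null scale UNIV UNIV) (\<lambda>c d. fbasis (a * c, b * d))"
    using bilinear_mod_fbasis[of scale]
    by (simp add: bilinear_mod_def distrib_left scale_mult_right)
qed

lemma bilinear_mod_tensor_lmult:
  "bilinear_mod scale fscale (tensor_null scale UNIV UNIV) (\<lambda>a b. tensor_lmult a b v)"
proof -
  let ?N = "tensor_null scale UNIV UNIV"
  note b = bilinear_mod_fbasis[of scale, unfolded bilinear_mod_def]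
  have "tensor_lmult (a + a') b v - tensor_lmult a b v - tensor_lmult a' b v \<in> ?N"
    "tensor_lmult (scale c a) b v - fscale c (tensor_lmult a b v) \<in> ?N"
    "tensor_lmult a (b + b') v - tensor_lmult a b v - tensor_lmult a b' v \<in> ?N"
    "tensor_lmult a (scale c b) v - fscale c (tensor_lmult a b v) \<in> ?N" for a a' b b' c
    unfolding tensor_lmult_def fsum.lin_ext_function_diff fsum.lin_ext_function_scale
    using b by (intro fsum.lin_ext_in_subspace subspace_tensor_null;
        simp add: distrib_right scale_mult_left split: prod.splits)+
  then show ?thesis unfolding bilinear_mod_def by blast
qed

lemma tensor_mult_lmult: "tensor_mult u v = lin_ext fscale (\<lambda>(a, b). tensor_lmult a b v) u"
  by (simp add: tensor_mult_def tensor_lmult_def)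

lemma tensor_mult_cong:
  assumes "tensor_eq scale u u'" "tensor_eq scale v v'"
  shows "tensor_eq scale (tensor_mult u v) (tensor_mult u' v')"
proof -
  have "tensor_mult (u - u') v \<in> tensor_null scale UNIV UNIV"
    using assms(1) unfolding tensor_mult_lmult
    by (intro bilinear_mod_tensor_null[OF vector_space_fscale subspace_tensor_null
          bilinear_mod_tensor_lmult]) (simp add: tensor_eq_def)
  moreover have "tensor_mult u' (v - v') \<in> tensor_null scale UNIV UNIV"
    using assms(2) unfolding tensor_mult_lmult
    by (intro fsum.lin_ext_in_subspace subspace_tensor_null)
      (auto simp: tensor_eq_def intro!: tensor_lmult_null)
  moreover have "tensor_mult (u - u') v = tensor_mult u v - tensor_mult u' v"
    by (simp add: tensor_mult_lmult fsum.lin_ext_diff)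
  moreover have "tensor_mult u' (v - v') = tensor_mult u' v - tensor_mult u' v'"
    by (simp add: tensor_mult_lmult tensor_lmult_diff fsum.lin_ext_function_diff case_prod_unfold)
  ultimately have "(tensor_mult u v - tensor_mult u' v) + (tensor_mult u' v - tensor_mult u' v')
      \<in> tensor_null scale UNIV UNIV"
    by (metis fsum.subspace_add subspace_tensor_null)
  then show ?thesis by (simp add: tensor_eq_def)
qed

lemma tensor_lmult_formal_sums:
  assumes "v \<in> formal_sums (P \<times> Q)" "\<And>c. c \<in> P \<Longrightarrow> a * c \<in> P'" "\<And>d. d \<in> Q \<Longrightarrow> b * d \<in> Q'"
  shows "tensor_lmult a b v \<in> formal_sums (P' \<times> Q')"
  unfolding tensor_lmult_def using assms
  by (intro fsum.lin_ext_in_subspace subspace_formal_sums)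
    (auto simp: formal_sums_def fbasis_def split: if_splits)

end

section \<open>Criteria for exact factorizations\<close>

lemma lin_ext_tensor_lmult:
  assumes "vector_space t"
  shows "lin_ext t \<phi> (tensor_lmult a b v) = lin_ext t (\<lambda>(c, d). \<phi> (a * c, b * d)) v"
proof -
  interpret t: vector_space t by fact
  show ?thesis
    unfolding tensor_lmult_def
    by (subst linear_lin_ext[OF t.lin_ext_linear]) (simp add: case_prod_unfold)
qed

context k_algebra
begin

abbreviation (input) mult_eval :: "('h \<times> 'h \<Rightarrow>\<^sub>0 'k) \<Rightarrow> 'h" where
  "mult_eval \<equiv> lin_ext scale (\<lambda>(b, t). b * t)"

lemma mult_eval_null:
  assumes "u \<in> tensor_null scale V W"
  shows "mult_eval u = 0"
proof -
  have "mult_eval u \<in> {0}"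
    using assms
    by (rule bilinear_mod_tensor_null[OF vector_space_axioms subspace_single_0, rotated])
      (simp add: bilinear_mod_def distrib_left distrib_right scale_mult_left scale_mult_right)
  then show ?thesis by simp
qed

text \<open>
  Multiplication is bilinear, so evaluation is constant on classes and \<^const>\<open>the_elem\<close> is applied to a
  singleton.
\<close>

lemma mult_map_class:
  assumes u: "u \<in> formal_sums (B \<times> T)"
  shows "mult_map scale (tensor_rel scale B T `` {u}) = mult_eval u"
proof -
  have "u \<in> tensor_rel scale B T `` {u}"
    using u fsum.subspace_0[OF subspace_tensor_null] by (auto simp: tensor_rel_def)
  moreover have "mult_eval u' = mult_eval u" if "u' \<in> tensor_rel scale B T `` {u}" for u'
  proof -
    have "mult_eval (u - u') = 0"
      using that by (intro mult_eval_null[of _ B T]) (simp add: tensor_rel_def)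
    then show ?thesis by (simp add: lin_ext_diff)
  qed
  ultimately have "mult_eval ` (tensor_rel scale B T `` {u}) = {mult_eval u}" by blast
  then show ?thesis by (simp add: mult_map_def)
qed

lemma tensor_class_eq_iff:
  assumes "u \<in> formal_sums (B \<times> T)" "v \<in> formal_sums (B \<times> T)"
  shows "tensor_rel scale B T `` {u} = tensor_rel scale B T `` {v} \<longleftrightarrow> u - v \<in> tensor_null scale B T"
proof
  let ?N = "tensor_null scale B T"
  assume "tensor_rel scale B T `` {u} = tensor_rel scale B T `` {v}"
  moreover have "v \<in> tensor_rel scale B T `` {v}"
    using assms fsum.subspace_0[OF subspace_tensor_null] by (auto simp: tensor_rel_def)
  ultimately show "u - v \<in> ?N" by (auto simp: tensor_rel_def)
next
  let ?N = "tensor_null scale B T"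
  assume uv: "u - v \<in> ?N"
  have "u - w \<in> ?N \<longleftrightarrow> v - w \<in> ?N" for w
  proof
    assume "u - w \<in> ?N"
    from fsum.subspace_diff[OF subspace_tensor_null this uv] show "v - w \<in> ?N" by simp
  next
    assume "v - w \<in> ?N"
    from fsum.subspace_add[OF subspace_tensor_null uv this] show "u - w \<in> ?N" by simp
  qed
  then have "(u, w) \<in> tensor_rel scale B T \<longleftrightarrow> (v, w) \<in> tensor_rel scale B T" for w
    using assms unfolding tensor_rel_def by blast
  then show "tensor_rel scale B T `` {u} = tensor_rel scale B T `` {v}" by blast
qed

text \<open>
  Replacing classes by representatives: a linear map on the quotient is injective if its kernel on
  formal sums consists of relations.
\<close>

lemma exact_factorization_iff:
  "exact_factorization scale B T \<longleftrightarrow>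
     (\<forall>h. \<exists>u\<in>formal_sums (B \<times> T). mult_eval u = h) \<and>
     (\<forall>u\<in>formal_sums (B \<times> T). mult_eval u = 0 \<longrightarrow> u \<in> tensor_null scale B T)"
proof -
  let ?F = "formal_sums (B \<times> T)" and ?c = "\<lambda>u. tensor_rel scale B T `` {u}"
  have tp: "tensor_product scale B T = ?c ` ?F"
    by (auto simp: tensor_product_def quotient_def)
  have surj: "mult_map scale ` tensor_product scale B T = mult_eval ` ?F"
    unfolding tp image_image by (rule image_cong[OF refl mult_map_class])
  have surj_onto: "mult_eval ` ?F = UNIV \<longleftrightarrow> (\<forall>h. \<exists>u\<in>?F. mult_eval u = h)"
    unfolding set_eq_iff image_iff by (metis UNIV_I)
  have diff: "u - v \<in> ?F" if "u \<in> ?F" "v \<in> ?F" for u v :: "'h \<times> 'h \<Rightarrow>\<^sub>0 'k"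
    using that by (rule fsum.subspace_diff[OF subspace_formal_sums])
  have zero: "0 \<in> ?F" by (rule fsum.subspace_0[OF subspace_formal_sums])
  have inj: "inj_on (mult_map scale) (tensor_product scale B T) \<longleftrightarrow>
      (\<forall>u\<in>?F. \<forall>v\<in>?F. mult_eval u = mult_eval v \<longrightarrow> u - v \<in> tensor_null scale B T)"
    unfolding tp inj_on_def by (simp add: mult_map_class tensor_class_eq_iff)
  also have "\<dots> \<longleftrightarrow> (\<forall>u\<in>?F. mult_eval u = 0 \<longrightarrow> u \<in> tensor_null scale B T)"
    (is "?L \<longleftrightarrow> ?R")
  proof
    assume L: ?L
    show ?R
    proof (intro ballI impI)
      fix u assume "u \<in> ?F" "mult_eval u = 0"
      then show "u \<in> tensor_null scale B T" using L[rule_format, of u 0] zero by simp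
    qed
  next
    assume R: ?R
    show ?L
    proof (intro ballI impI)
      fix u v assume uv: "u \<in> ?F" "v \<in> ?F" and eq: "mult_eval u = mult_eval v"
      have "mult_eval (u - v) = 0" using eq by (simp add: lin_ext_diff)
      then show "u - v \<in> tensor_null scale B T" using R diff uv by blast
    qed
  qed
  finally show ?thesis
    unfolding exact_factorization_def bij_betw_def surj
    by (simp add: surj_onto conj_commute)
qed

text \<open>
  The tensor \<open>h \<otimes> 1 - 1 \<otimes> h\<close> is killed by multiplication, hence is zero, and \<open>\<alpha> \<otimes> \<beta>\<close> is
  evaluated on it.  Used with coordinate functionals, this shows that the two factors have little in
  common.
\<close>

lemma exact_factorization_common:
  assumes ex: "exact_factorization scale B T"
    and h: "h \<in> B" "h \<in> T" and one: "1 \<in> B" "1 \<in> T"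
    and \<alpha>: "Vector_Spaces.linear scale (*) \<alpha>" and \<beta>: "Vector_Spaces.linear scale (*) \<beta>"
  shows "\<alpha> h * \<beta> 1 = \<alpha> 1 * \<beta> h"
proof -
  interpret a: Vector_Spaces.linear scale "(*)" \<alpha> by fact
  interpret b: Vector_Spaces.linear scale "(*)" \<beta> by fact
  let ?u = "fbasis (h, 1) - fbasis (1, h) :: 'h \<times> 'h \<Rightarrow>\<^sub>0 'k"
  have "?u \<in> formal_sums (B \<times> T)"
    using h one by (intro fsum.subspace_diff[OF subspace_formal_sums] fbasis_in_formal_sums) auto
  moreover have "mult_eval ?u = 0" by (simp add: lin_ext_diff)
  ultimately have "?u \<in> tensor_null scale B T"
    using ex by (simp add: exact_factorization_iff)
  moreover have "bilinear_mod scale (*) {0} (\<lambda>b c. \<alpha> b * \<beta> c)"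
    by (simp add: bilinear_mod_def a.add b.add a.scale b.scale distrib_left distrib_right
        mult.assoc mult.left_commute del: a.vs2.scale_scale)
  ultimately have "lin_ext (*) (\<lambda>(b, c). \<alpha> b * \<beta> c) ?u \<in> {0}"
    by (intro bilinear_mod_tensor_null[OF a.vs2.vector_space_axioms]) (auto simp: a.vs2.subspace_def)
  then show ?thesis by (simp add: a.vs2.lin_ext_diff)
qed

lemma mult_eval_image: "mult_eval ` formal_sums (B \<times> T) = span ((\<lambda>(b, t). b * t) ` (B \<times> T))"
proof -
  interpret m: Vector_Spaces.linear fscale scale mult_eval by (rule lin_ext_linear)
  have "mult_eval ` formal_sums (B \<times> T) = span (mult_eval ` fbasis ` (B \<times> T))"
    unfolding formal_sums_eq_span m.span_image ..
  also have "mult_eval ` fbasis ` (B \<times> T) = (\<lambda>(b, t). b * t) ` (B \<times> T)"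
    by (simp add: image_image)
  finally show ?thesis .
qed

lemma exact_factorization_span:
  assumes "exact_factorization scale B T"
  shows "span ((\<lambda>(b, t). b * t) ` (B \<times> T)) = UNIV"
proof -
  have "h \<in> mult_eval ` formal_sums (B \<times> T)" for h
  proof -
    obtain u where "u \<in> formal_sums (B \<times> T)" "mult_eval u = h"
      using assms unfolding exact_factorization_iff by blast
    then show ?thesis by blast
  qed
  then show ?thesis unfolding mult_eval_image by blast
qed

text \<open>
  The map \<open>\<sigma>\<close> is an inverse of multiplication, written on representatives.  The difference
  \<open>b \<otimes> t - \<sigma>(b t)\<close> is bilinear modulo the relations and vanishes on \<open>X \<times> Y\<close>, so it is a relation
  for all \<open>b\<close> and \<open>t\<close> in the spans; hence every formal sum agrees, up to relations, with \<open>\<sigma>\<close> of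
  its product.
\<close>

lemma exact_factorization_sectionI:
  assumes \<sigma>: "Vector_Spaces.linear scale fscale \<sigma>"
    and \<sigma>_mult: "\<And>a b. a \<in> X \<Longrightarrow> b \<in> Y \<Longrightarrow> \<sigma> (a * b) = fbasis (a, b)"
    and span_XY: "span ((\<lambda>(a, b). a * b) ` (X \<times> Y)) = UNIV"
  shows "exact_factorization scale (span X) (span Y)"
proof -
  interpret \<sigma>: Vector_Spaces.linear scale fscale \<sigma> by (rule \<sigma>)
  let ?N = "tensor_null scale (span X) (span Y)"
  let ?\<phi> = "\<lambda>b t. fbasis (b, t) - \<sigma> (b * t)"
  note N = subspace_tensor_null[of scale "span X" "span Y"]
  have left: "b \<in> span X \<and> ?\<phi> b t \<in> ?N" if b: "b \<in> span X" and t: "t \<in> Y" for b t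
    using b
  proof (induction rule: span_induct_alt)
    case base
    have "fbasis (scale 0 0, t) - fscale 0 (fbasis (0, t)) \<in> ?N"
      using t by (intro tensor_null_rels(2) span_zero span_base)
    then show ?case by (simp add: span_zero)
  next
    case (step c a b)
    have "fbasis (scale c a + b, t) - fbasis (scale c a, t) - fbasis (b, t) \<in> ?N"
      "fbasis (scale c a, t) - fscale c (fbasis (a, t)) \<in> ?N"
      using step t by (simp_all add: tensor_null_rels span_scale span_base)
    then have "(fbasis (scale c a + b, t) - fbasis (scale c a, t) - fbasis (b, t))
        + (fbasis (scale c a, t) - fscale c (fbasis (a, t))) + ?\<phi> b t \<in> ?N"
      using step.IH by (intro fsum.subspace_add N) auto
    moreover have "\<sigma> ((scale c a + b) * t) = fscale c (fbasis (a, t)) + \<sigma> (b * t)"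
      using \<sigma>_mult[OF step.hyps(1) t] by (simp add: distrib_right scale_mult_left \<sigma>.add \<sigma>.scale)
    ultimately show ?case
      using step by (simp add: span_add span_scale span_base algebra_simps)
  qed
  have both: "t \<in> span Y \<and> ?\<phi> b t \<in> ?N" if b: "b \<in> span X" and t: "t \<in> span Y" for b t
    using t
  proof (induction rule: span_induct_alt)
    case base
    have "fbasis (b, scale 0 0) - fscale 0 (fbasis (b, 0)) \<in> ?N"
      using b by (intro tensor_null_rels(4) span_zero)
    then show ?case by (simp add: span_zero)
  next
    case (step c a t)
    have "fbasis (b, scale c a + t) - fbasis (b, scale c a) - fbasis (b, t) \<in> ?N"
      "fbasis (b, scale c a) - fscale c (fbasis (b, a)) \<in> ?N"
      using step b by (simp_all add: tensor_null_rels span_scale span_base)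
    then have "(fbasis (b, scale c a + t) - fbasis (b, scale c a) - fbasis (b, t))
        + (fbasis (b, scale c a) - fscale c (fbasis (b, a))) + fscale c (?\<phi> b a) + ?\<phi> b t \<in> ?N"
      using step.IH left[OF b step.hyps(1)] by (intro fsum.subspace_add fsum.subspace_scale N) auto
    moreover have "\<sigma> (b * (scale c a + t)) = fscale c (\<sigma> (b * a)) + \<sigma> (b * t)"
      by (simp add: distrib_left scale_mult_right \<sigma>.add \<sigma>.scale)
    ultimately show ?case
      using step by (simp add: span_add span_scale span_base algebra_simps fsum.scale_right_diff_distrib)
  qed
  show ?thesis
    unfolding exact_factorization_iff
  proof (intro conjI allI ballI impI)
    fix h
    have "h \<in> span ((\<lambda>(a, b). a * b) ` (span X \<times> span Y))"
      using span_mono[of "(\<lambda>(a, b). a * b) ` (X \<times> Y)" "(\<lambda>(a, b). a * b) ` (span X \<times> span Y)"]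
        span_XY span_superset by blast
    then show "\<exists>u\<in>formal_sums (span X \<times> span Y). mult_eval u = h"
      unfolding mult_eval_image[symmetric] by blast
  next
    fix u assume u: "u \<in> formal_sums (span X \<times> span Y)" "mult_eval u = 0"
    have "lin_ext fscale (\<lambda>(b, t). ?\<phi> b t) u \<in> ?N"
      using u(1) by (intro fsum.lin_ext_in_subspace N) (use both in \<open>auto simp: formal_sums_def\<close>)
    moreover have "\<sigma> (mult_eval u) = lin_ext fscale (\<lambda>(b, t). \<sigma> (b * t)) u"
      by (subst linear_lin_ext[OF \<sigma>]) (simp add: case_prod_unfold)
    then have "lin_ext fscale (\<lambda>(b, t). \<sigma> (b * t)) u = 0" by (simp add: u(2) \<sigma>.zero)
    moreover have "lin_ext fscale (\<lambda>(b, t). ?\<phi> b t) u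
        = lin_ext fscale fbasis u - lin_ext fscale (\<lambda>(b, t). \<sigma> (b * t)) u"
      by (simp add: fsum.lin_ext_function_diff case_prod_unfold)
    ultimately show "u \<in> ?N" by (simp add: lin_ext_fbasis_self)
  qed
qed

end

section \<open>Slicing coproducts by linear functionals\<close>

context hopf_algebra
begin

text \<open>
  This will be applied to \<open>a = x\<close>, whose coproduct is a sum of two pure tensors; it makes inductions on
  the power of \<open>x\<close> possible.
\<close>

lemma comult_mult_split:
  assumes "tensor_eq scale (\<Delta> a) (fbasis (a\<^sub>1, a\<^sub>2) + fbasis (b\<^sub>1, b\<^sub>2))" "tensor_eq scale (\<Delta> h) u"
  shows "tensor_eq scale (\<Delta> (a * h)) (tensor_lmult a\<^sub>1 a\<^sub>2 u + tensor_lmult b\<^sub>1 b\<^sub>2 u)"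
  using tensor_eq_trans[OF comult_mult tensor_mult_cong[OF assms]]
  by (simp add: tensor_mult_lmult fsum.lin_ext_add)

text \<open>
  The slices \<open>(\<alpha> \<otimes> id) (\<Delta> h)\<close> and \<open>(id \<otimes> \<alpha>) (\<Delta> h)\<close> of a coproduct.  They do not depend on the formal
  sum that represents \<open>\<Delta> h\<close>, and they are the means of producing new elements of a Hopf subalgebra.
\<close>

definition hit_left :: "('h \<Rightarrow> 'k) \<Rightarrow> 'h \<Rightarrow> 'h" where
  "hit_left \<alpha> h = lin_ext scale (\<lambda>(b, c). scale (\<alpha> b) c) (\<Delta> h)"

definition hit_right :: "('h \<Rightarrow> 'k) \<Rightarrow> 'h \<Rightarrow> 'h" where
  "hit_right \<alpha> h = lin_ext scale (\<lambda>(b, c). scale (\<alpha> c) b) (\<Delta> h)"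

context
  fixes \<alpha> :: "'h \<Rightarrow> 'k"
  assumes \<alpha>: "Vector_Spaces.linear scale (*) \<alpha>"
begin

interpretation \<alpha>: Vector_Spaces.linear scale "(*)" \<alpha> by (rule \<alpha>)

lemma bilinear_hit:
  "bilinear_mod scale scale {0} (\<lambda>b c. scale (\<alpha> b) c)"
  "bilinear_mod scale scale {0} (\<lambda>b c. scale (\<alpha> c) b)"
  by (simp_all add: bilinear_mod_def \<alpha>.add \<alpha>.scale scale_left_distrib scale_right_distrib mult.commute)

lemmas hit_left_eq = bilinear_tensor_eq[where u = "\<Delta> h" for h, OF vector_space_axioms bilinear_hit(1), folded hit_left_def]
lemmas hit_right_eq = bilinear_tensor_eq[where u = "\<Delta> h" for h, OF vector_space_axioms bilinear_hit(2), folded hit_right_def]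

lemma linear_hit_left: "Vector_Spaces.linear scale scale (hit_left \<alpha>)"
  using hit_left_eq[OF comult_add] hit_left_eq[OF comult_scale]
  by (intro Vector_Spaces.linear_iff[THEN iffD2] conjI allI vector_space_axioms)
    (simp_all add: lin_ext_add lin_ext_fscale hit_left_def)

lemma linear_hit_right: "Vector_Spaces.linear scale scale (hit_right \<alpha>)"
  using hit_right_eq[OF comult_add] hit_right_eq[OF comult_scale]
  by (intro Vector_Spaces.linear_iff[THEN iffD2] conjI allI vector_space_axioms)
    (simp_all add: lin_ext_add lin_ext_fscale hit_right_def)

lemma hit_in_hopf_subalgebra:
  assumes C: "hopf_subalgebra scale \<Delta> S C" and h: "h \<in> C"
  shows "hit_left \<alpha> h \<in> C" "hit_right \<alpha> h \<in> C"
proof -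
  obtain u where u: "u \<in> formal_sums (C \<times> C)" "tensor_eq scale (\<Delta> h) u"
    using C h by (auto simp: hopf_subalgebra_def)
  have sub: "subspace C" using C by (simp add: hopf_subalgebra_def)
  show "hit_left \<alpha> h \<in> C" "hit_right \<alpha> h \<in> C"
    unfolding hit_left_eq[OF u(2)] hit_right_eq[OF u(2)] using u(1)
    by (auto intro!: lin_ext_in_subspace subspace_scale sub simp: formal_sums_def)
qed

end

lemma linear_compose_mult:
  assumes "Vector_Spaces.linear scale (*) \<alpha>"
  shows "Vector_Spaces.linear scale (*) (\<lambda>b. \<alpha> (a * b))"
  using assms by (simp add: Vector_Spaces.linear_iff distrib_left scale_mult_right)

lemma hit_mult_split:
  assumes \<alpha>: "Vector_Spaces.linear scale (*) \<alpha>"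
    and a: "tensor_eq scale (\<Delta> a) (fbasis (a\<^sub>1, a\<^sub>2) + fbasis (b\<^sub>1, b\<^sub>2))"
  shows "hit_left \<alpha> (a * h) = a\<^sub>2 * hit_left (\<lambda>c. \<alpha> (a\<^sub>1 * c)) h + b\<^sub>2 * hit_left (\<lambda>c. \<alpha> (b\<^sub>1 * c)) h"
    and "hit_right \<alpha> (a * h) = a\<^sub>1 * hit_right (\<lambda>c. \<alpha> (a\<^sub>2 * c)) h + b\<^sub>1 * hit_right (\<lambda>c. \<alpha> (b\<^sub>2 * c)) h"
proof -
  have lin: "Vector_Spaces.linear scale scale (\<lambda>b. c * b)" for c
    by (simp add: Vector_Spaces.linear_iff vector_space_axioms distrib_left scale_mult_right)
  note eq = comult_mult_split[OF a tensor_eq_refl]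
  show "hit_left \<alpha> (a * h) = a\<^sub>2 * hit_left (\<lambda>c. \<alpha> (a\<^sub>1 * c)) h + b\<^sub>2 * hit_left (\<lambda>c. \<alpha> (b\<^sub>1 * c)) h"
    unfolding hit_left_eq[OF \<alpha> eq] unfolding hit_left_def linear_lin_ext[OF lin]
    by (simp add: lin_ext_add lin_ext_tensor_lmult vector_space_axioms scale_mult_right case_prod_unfold)
  show "hit_right \<alpha> (a * h) = a\<^sub>1 * hit_right (\<lambda>c. \<alpha> (a\<^sub>2 * c)) h + b\<^sub>1 * hit_right (\<lambda>c. \<alpha> (b\<^sub>2 * c)) h"
    unfolding hit_right_eq[OF \<alpha> eq] unfolding hit_right_def linear_lin_ext[OF lin]
    by (simp add: lin_ext_add lin_ext_tensor_lmult vector_space_axioms scale_mult_right case_prod_unfold)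
qed

lemma comult_span_closed:
  assumes C: "subspace C"
    and X: "\<And>h. h \<in> X \<Longrightarrow> \<exists>u\<in>formal_sums (C \<times> C). tensor_eq scale (\<Delta> h) u"
    and h: "h \<in> span X"
  shows "\<exists>u\<in>formal_sums (C \<times> C). tensor_eq scale (\<Delta> h) u"
  using h
proof (induction rule: span_induct_alt)
  case base
  have "tensor_eq scale (\<Delta> (scale 0 0)) (fscale 0 (\<Delta> 0))" by (rule comult_scale)
  then have "tensor_eq scale (\<Delta> 0) 0" by simp
  then show ?case using fsum.subspace_0[OF subspace_formal_sums] by blast
next
  case (step c x y)
  obtain u v where u: "u \<in> formal_sums (C \<times> C)" "tensor_eq scale (\<Delta> x) u"
    and v: "v \<in> formal_sums (C \<times> C)" "tensor_eq scale (\<Delta> y) v"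
    using X[OF step.hyps(1)] step.IH by blast
  have "tensor_eq scale (\<Delta> (scale c x + y)) (fscale c u + v)"
    using comult_add comult_scale u(2) v(2)
    by (meson tensor_eq_trans tensor_eq_add tensor_eq_fscale tensor_eq_refl)
  moreover have "fscale c u + v \<in> formal_sums (C \<times> C)"
    using u(1) v(1) by (intro fsum.subspace_add fsum.subspace_scale subspace_formal_sums)
  ultimately show ?case by blast
qed

lemma antipode_bilinear: "bilinear_mod scale scale {0} (\<lambda>b c. S b * c)"
proof -
  interpret S: Vector_Spaces.linear scale scale S by (rule antipode_linear)
  show ?thesis
    by (simp add: bilinear_mod_def S.add S.scale distrib_left distrib_right scale_mult_left scale_mult_right)
qed

end

section \<open>Normal forms in the third-type algebras\<close>

locale third_type_setting = third_type_hopf_algebra scale \<Delta> \<epsilon> S G g f \<iota> x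
  for scale :: "'k::field \<Rightarrow> 'h::ring_1 \<Rightarrow> 'h" and \<Delta> \<epsilon> S
    and G :: "('g, 'm) monoid_scheme" (structure) and g f \<iota> x +
  assumes CHAR_pos: "CHAR('k) > 0"
    and datum: "third_type_datum G g f"
begin

sublocale group G
  using datum by (simp add: third_type_datum_def)

lemma finite_G: "finite (carrier G)"
  and g_closed [simp, intro]: "g \<in> carrier G"
  and f_g: "f g = 1"
  using datum by (auto simp: third_type_datum_def)

lemma g_central: "t \<in> carrier G \<Longrightarrow> t \<otimes> g = g \<otimes> t"
  and f_mult: "s \<in> carrier G \<Longrightarrow> t \<in> carrier G \<Longrightarrow> f (s \<otimes> t) = f s + f t"
  using datum by (auto simp: third_type_datum_def)

lemma f_one: "f \<one> = 0"
proof -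
  have "f \<one> + f \<one> = f \<one> + 0" using f_mult[of \<one> \<one>] by simp
  then show ?thesis by (rule add_left_imp_eq)
qed

lemma g_neq_one: "g \<noteq> \<one>"
  using f_one f_g by auto

lemma prime_p: "prime CHAR('k)"
  using CHAR_pos by (rule prime_CHAR_semidom)

lemma p_gt_1: "1 < CHAR('k)"
  using prime_p by (rule prime_gt_1_nat)

text \<open>
  The elements \<open>1\<close> and \<open>g\<^sup>p\<close> of the basis \<open>G\<close> of \<open>k[G]\<close> are equal or linearly independent.
\<close>

lemma datum_cases:
  assumes "t \<in> carrier G"
  shows "f t ^ CHAR('k) = f t \<or> g [^] CHAR('k) = \<one>"
  using datum assms by (auto simp: third_type_datum_def)

lemma f_g_pow: "r \<in> carrier G \<Longrightarrow> f (r \<otimes> g [^] n) = f r + of_nat n" for n :: nat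
proof (induction n)
  case (Suc n)
  then show ?case using f_mult[of "r \<otimes> g [^] n" g] by (simp add: m_assoc f_g)
qed simp

lemma word_eval_rel:
  assumes "r \<in> third_type_rels G g f"
  shows "word_eval scale (case_gen \<iota> x) r = 0"
proof -
  have "r = lin_ext fscale (\<lambda>w. fbasis ([] @ w @ [])) r"
    by (simp add: lin_ext_fbasis_self)
  then have "r \<in> ideal_generated (third_type_gens G) (third_type_rels G g f)"
    unfolding ideal_generated_def using assms by (intro fsum.span_base) blast
  then show ?thesis using presentation by (auto simp: presented_by_def)
qed

lemma iota_mult: "s \<in> carrier G \<Longrightarrow> t \<in> carrier G \<Longrightarrow> \<iota> (s \<otimes> t) = \<iota> s * \<iota> t"
proof -
  assume "s \<in> carrier G" "t \<in> carrier G"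
  then have "fbasis [GenG s, GenG t] - fbasis [GenG (s \<otimes> t)] \<in> third_type_rels G g f"
    unfolding third_type_rels_def by blast
  from word_eval_rel[OF this] show ?thesis
    by (simp add: word_eval_def lin_ext_diff)
qed

lemma iota_one: "\<iota> \<one> = 1"
  using word_eval_rel[of "fbasis [GenG \<one>] - fbasis []"]
  by (auto simp: third_type_rels_def word_eval_def lin_ext_diff)

lemma iota_x:
  assumes "t \<in> carrier G"
  shows "\<iota> t * x = x * \<iota> t + scale (f t) (\<iota> t - \<iota> (t \<otimes> g))"
proof -
  let ?r = "fbasis [GenG t, GenX] - fbasis [GenX, GenG t]
        - fscale (f t) (fbasis [GenG t] - fbasis [GenG t, GenG g])"
  have "?r \<in> third_type_rels G g f"
    using assms unfolding third_type_rels_def by blast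
  from word_eval_rel[OF this]
  have "\<iota> t * x - x * \<iota> t - scale (f t) (\<iota> t - \<iota> t * \<iota> g) = 0"
    by (simp add: word_eval_def lin_ext_diff lin_ext_fscale)
  then show ?thesis using assms by (simp add: iota_mult algebra_simps)
qed

lemma x_power_p: "x ^ CHAR('k) = x"
proof -
  have "fbasis (replicate CHAR('k) GenX) - fbasis [GenX] \<in> third_type_rels G g f"
    unfolding third_type_rels_def by blast
  from word_eval_rel[OF this] show ?thesis
    by (simp add: word_eval_def lin_ext_diff prod_list_replicate)
qed

text \<open>
  The span of the \<open>x\<^sup>i u\<close> with \<open>u \<in> U\<close> and degree \<open>i\<close> less than \<open>n\<close>.  The two extreme cases are the ones
  of interest: \<open>n = 1\<close> is the group algebra of \<open>U\<close>, and \<open>n = p\<close> is the algebra generated by \<open>x\<close> and \<open>U\<close> when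
  \<open>U\<close> is a subgroup that contains \<open>g\<close>.
\<close>

definition filt :: "'g set \<Rightarrow> nat \<Rightarrow> 'h set" where
  "filt U n = span ((\<lambda>(i, u). x ^ i * \<iota> u) ` ({..<n} \<times> U))"

lemma subspace_filt [simp]: "subspace (filt U n)"
  by (simp add: filt_def)

lemma filt_base: "i < n \<Longrightarrow> u \<in> U \<Longrightarrow> x ^ i * \<iota> u \<in> filt U n"
  unfolding filt_def by (rule span_base, rule image_eqI[of _ _ "(i, u)"]) auto

lemma filt_mono: "n \<le> m \<Longrightarrow> U \<subseteq> V \<Longrightarrow> filt U n \<subseteq> filt V m"
  unfolding filt_def by (intro span_mono image_mono Sigma_mono) auto

lemma filt_minimal:
  assumes "subspace N" "\<And>i u. i < n \<Longrightarrow> u \<in> U \<Longrightarrow> x ^ i * \<iota> u \<in> N"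
  shows "filt U n \<subseteq> N"
  unfolding filt_def using assms by (intro span_minimal) auto

lemma subspace_left_mult_preimage: "subspace N \<Longrightarrow> subspace {h. a * h \<in> N}"
  and subspace_right_mult_preimage: "subspace N \<Longrightarrow> subspace {h. h * a \<in> N}"
  unfolding subspace_def by (simp_all add: distrib_left distrib_right scale_mult_left scale_mult_right)

lemma x_mult_filt:
  assumes "h \<in> filt U n"
  shows "x * h \<in> filt U (Suc n)"
proof -
  have "x * (x ^ i * \<iota> u) \<in> filt U (Suc n)" if "i < n" "u \<in> U" for i u
    using filt_base[of "Suc i" "Suc n" u U] that by (simp add: mult.assoc)
  then have "filt U n \<subseteq> {h. x * h \<in> filt U (Suc n)}"
    by (intro filt_minimal) (auto simp: subspace_left_mult_preimage)
  then show ?thesis using assms by blast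
qed

lemma x_mult_filt_p:
  assumes "h \<in> filt U CHAR('k)"
  shows "x * h \<in> filt U CHAR('k)"
proof -
  have "x * (x ^ i * \<iota> u) \<in> filt U CHAR('k)" if "i < CHAR('k)" "u \<in> U" for i u
  proof (cases "Suc i = CHAR('k)")
    case True
    then have "x * (x ^ i * \<iota> u) = x ^ 1 * \<iota> u"
      using x_power_p by (metis mult.assoc power_Suc power_one_right)
    then show ?thesis using filt_base[OF p_gt_1 that(2)] by simp
  next
    case False
    then show ?thesis using filt_base[of "Suc i" "CHAR('k)" u U] that by (simp add: mult.assoc)
  qed
  then have "filt U CHAR('k) \<subseteq> {h. x * h \<in> filt U CHAR('k)}"
    by (intro filt_minimal) (auto simp: subspace_left_mult_preimage)
  then show ?thesis using assms by blast
qed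

lemma x_power_mult_filt_p: "h \<in> filt U CHAR('k) \<Longrightarrow> x ^ i * h \<in> filt U CHAR('k)"
  by (induction i) (simp_all add: mult.assoc x_mult_filt_p)

text \<open>
  Moving \<open>s\<close> past one \<open>x\<close> costs \<open>f(s) (s - s g)\<close>, which has smaller degree in \<open>x\<close>.  The set \<open>V\<close> has to be
  stable under \<open>g\<close> because of the term \<open>s g\<close>.
\<close>

lemma iota_mult_basis:
  assumes "s \<in> carrier G" "u \<in> carrier G" "s \<otimes> u \<in> V" and gV: "\<And>v. v \<in> V \<Longrightarrow> g \<otimes> v \<in> V"
  shows "\<iota> s * (x ^ i * \<iota> u) - x ^ i * \<iota> (s \<otimes> u) \<in> filt V i"
  using assms(1,3)
proof (induction i arbitrary: s)
  case 0
  then show ?case using assms(2) subspace_0 by (simp add: iota_mult)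
next
  case (Suc i)
  have sg: "s \<otimes> g \<otimes> u = g \<otimes> (s \<otimes> u)" "s \<otimes> g \<in> carrier G"
    using Suc.prems assms(2) by (simp_all add: g_central m_assoc)
  have step: "\<iota> t * (x ^ i * \<iota> u) \<in> filt V (Suc i)" if "t \<in> carrier G" "t \<otimes> u \<in> V" for t
  proof -
    have "\<iota> t * (x ^ i * \<iota> u) - x ^ i * \<iota> (t \<otimes> u) \<in> filt V (Suc i)"
      using Suc.IH[OF that] filt_mono[of i "Suc i" V V] by auto
    from subspace_add[OF subspace_filt this filt_base[of i "Suc i" "t \<otimes> u" V]] show ?thesis
      using that by simp
  qed
  have "\<iota> s * (x * h) = x * (\<iota> s * h) + scale (f s) (\<iota> s * h - \<iota> (s \<otimes> g) * h)" for h
    using arg_cong[OF iota_x[OF Suc.prems(1)], of "\<lambda>y. y * h"]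
    by (simp add: distrib_right left_diff_distrib scale_mult_left mult.assoc)
  then have "\<iota> s * (x ^ Suc i * \<iota> u) - x ^ Suc i * \<iota> (s \<otimes> u)
      = x * (\<iota> s * (x ^ i * \<iota> u) - x ^ i * \<iota> (s \<otimes> u))
        + scale (f s) (\<iota> s * (x ^ i * \<iota> u) - \<iota> (s \<otimes> g) * (x ^ i * \<iota> u))"
    by (simp add: mult.assoc right_diff_distrib)
  also have "\<dots> \<in> filt V (Suc i)"
    using Suc.prems sg gV[of "s \<otimes> u"]
    by (intro subspace_add subspace_scale subspace_diff subspace_filt step x_mult_filt Suc.IH) simp_all
  finally show ?case .
qed

lemma iota_mult_filt:
  assumes "s \<in> carrier G" "U \<subseteq> carrier G" "\<And>u. u \<in> U \<Longrightarrow> s \<otimes> u \<in> V"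
    and gV: "\<And>v. v \<in> V \<Longrightarrow> g \<otimes> v \<in> V" and h: "h \<in> filt U n"
  shows "\<iota> s * h \<in> filt V n"
proof -
  have "\<iota> s * (x ^ i * \<iota> u) \<in> filt V n" if "i < n" "u \<in> U" for i u
  proof -
    have "\<iota> s * (x ^ i * \<iota> u) - x ^ i * \<iota> (s \<otimes> u) \<in> filt V n"
      using iota_mult_basis[of s u V i] filt_mono[of i n V V] that assms by auto
    from subspace_add[OF subspace_filt this filt_base[of i n "s \<otimes> u" V]] show ?thesis
      using that assms(3) by simp
  qed
  then have "filt U n \<subseteq> {h. \<iota> s * h \<in> filt V n}"
    by (intro filt_minimal) (auto simp: subspace_left_mult_preimage)
  then show ?thesis using h by blast
qed

text \<open>
  Every word in the generators can be normalized from the right, because the span on the left-hand side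
  is stable under left multiplication by \<open>x\<close> and by \<open>G\<close>.
\<close>

lemma filt_carrier: "filt (carrier G) CHAR('k) = UNIV"
proof -
  let ?W = "filt (carrier G) CHAR('k)"
  have "prod_list (map (case_gen \<iota> x) w) \<in> ?W" if "w \<in> lists (third_type_gens G)" for w
    using that
  proof (induction w)
    case Nil
    then show ?case using filt_base[of 0 "CHAR('k)" \<one> "carrier G"] CHAR_pos by (simp add: iota_one)
  next
    case (Cons a w)
    then show ?case
      by (cases a) (auto simp: third_type_gens_def intro: x_mult_filt_p iota_mult_filt[of _ "carrier G"])
  qed
  then have "word_eval scale (case_gen \<iota> x) u \<in> ?W" if "u \<in> formal_sums (lists (third_type_gens G))" for u
    unfolding word_eval_def using that by (intro lin_ext_in_subspace) (auto simp: formal_sums_def)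
  then have "word_eval scale (case_gen \<iota> x) ` formal_sums (lists (third_type_gens G)) \<subseteq> ?W" by blast
  then show ?thesis using presentation by (simp add: presented_by_def top.extremum_unique)
qed

section \<open>A family of modules and the basis \<open>x\<^sup>i t\<close>\<close>

text \<open>
  Functions on \<open>G\<close> rather than elements of \<open>k[G]\<close>, so that words act from the left and the action of \<open>x\<close>
  is a pointwise formula.  The scalar \<open>l\<close> twists the module; it is the eigenvalue of \<open>x\<close> on the functional
  \<open>\<phi> \<mapsto> \<phi>(1)\<close>, because \<open>f(1) = 0\<close>.
\<close>

definition act :: "'k \<Rightarrow> 'g gen \<Rightarrow> ('g \<Rightarrow> 'k) \<Rightarrow> 'g \<Rightarrow> 'k" where
  "act l y \<phi> r = (case y of GenG s \<Rightarrow> \<phi> (r \<otimes> s) | GenX \<Rightarrow> (f r + l) * \<phi> r - f r * \<phi> (r \<otimes> g))"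

lemma act_GenG: "act l (GenG s) \<phi> = (\<lambda>r. \<phi> (r \<otimes> s))"
  and act_GenX: "act l GenX \<phi> = (\<lambda>r. (f r + l) * \<phi> r - f r * \<phi> (r \<otimes> g))"
  by (simp_all add: fun_eq_iff act_def)

lemma vector_space_field: "vector_space ((*) :: 'k \<Rightarrow> 'k \<Rightarrow> 'k)"
  by unfold_locales (simp_all add: algebra_simps)

lemma act_word_lin_ext:
  "foldr (act l) w (\<lambda>r. lin_ext (*) (\<lambda>i. \<psi> i r) R) = (\<lambda>r. lin_ext (*) (\<lambda>i. foldr (act l) w (\<psi> i) r) R)"
proof (induction w)
  case (Cons a w)
  then show ?case
    by (cases a) (auto simp: fun_eq_iff act_GenG act_GenX lin_ext_def sum_distrib_left sum_subtractf algebra_simps)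
qed simp

text \<open>
  The relations hold for the action only at points of \<open>G\<close>; therefore the values at other elements of
  the ambient type must not influence the values on \<open>G\<close>.
\<close>

lemma act_word_zero:
  assumes "w \<in> lists (third_type_gens G)" "\<And>r. r \<in> carrier G \<Longrightarrow> \<psi> r = 0" "r \<in> carrier G"
  shows "foldr (act l) w \<psi> r = 0"
  using assms(1,3)
proof (induction w arbitrary: r)
  case Nil
  then show ?case using assms(2) by simp
next
  case (Cons a w)
  then show ?case by (cases a) (auto simp: act_GenG act_GenX third_type_gens_def)
qed

lemma act_x_power:
  fixes n m :: nat
  assumes "r \<in> carrier G"
  shows "(act l GenX ^^ m) \<phi> (r \<otimes> g [^] n)
    = (weighted_shift (f r) l ^^ m) (\<lambda>n. \<phi> (r \<otimes> g [^] n)) n"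
proof (induction m arbitrary: n)
  case (Suc m)
  let ?b = "(weighted_shift (f r) l ^^ m) (\<lambda>n. \<phi> (r \<otimes> g [^] n))"
  have next_pow: "r \<otimes> g [^] n \<otimes> g = r \<otimes> g [^] Suc n" using assms by (simp add: m_assoc)
  have "(act l GenX ^^ Suc m) \<phi> (r \<otimes> g [^] n) = act l GenX ((act l GenX ^^ m) \<phi>) (r \<otimes> g [^] n)"
    by simp
  also have "\<dots> = (f r + of_nat n + l) * ?b n - (f r + of_nat n) * ?b (Suc n)"
    unfolding act_GenX[of l "(act l GenX ^^ m) \<phi>"] next_pow Suc.IH f_g_pow[OF assms] ..
  also have "\<dots> = weighted_shift (f r) l ?b n"
    by (simp add: weighted_shift_def[of _ _ ?b] add_ac)
  finally show ?case by simp
qed simp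

text \<open>
  For \<open>x\<^sup>p = x\<close> the action is restricted to the coset of \<open>r\<close>, where it is a weighted shift.  The
  commutation relation reduces to \<open>f(r t) - f(r) = f(t)\<close>, by centrality of \<open>g\<close>.
\<close>

lemma act_rel:
  assumes R: "R \<in> third_type_rels G g f" and l: "l ^ CHAR('k) = l" and r: "r \<in> carrier G"
  shows "lin_ext (*) (\<lambda>w. foldr (act l) w \<phi> r) R = 0"
proof -
  interpret kvs: vector_space "(*) :: 'k \<Rightarrow> 'k \<Rightarrow> 'k" by (rule vector_space_field)
  note [simp] = kvs.lin_ext_diff kvs.lin_ext_fscale
  note [simp del] = kvs.scale_scale
  consider (mult) s t where "s \<in> carrier G" "t \<in> carrier G"
      "R = fbasis [GenG s, GenG t] - fbasis [GenG (s \<otimes> t)]"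
    | (one) "R = fbasis [GenG \<one>] - fbasis []"
    | (comm) t where "t \<in> carrier G" "R = fbasis [GenG t, GenX] - fbasis [GenX, GenG t]
        - fscale (f t) (fbasis [GenG t] - fbasis [GenG t, GenG g])"
    | (power) "R = fbasis (replicate CHAR('k) GenX) - fbasis [GenX]"
    using R unfolding third_type_rels_def by blast
  then show ?thesis
  proof cases
    case mult
    then show ?thesis using r by (simp add: act_GenG m_assoc)
  next
    case one
    then show ?thesis using r by (simp add: act_GenG)
  next
    case comm
    then have "r \<otimes> t \<otimes> g = r \<otimes> g \<otimes> t" using r by (simp add: m_assoc g_central)
    then show ?thesis using comm r by (simp add: act_GenG act_GenX f_mult distrib_right right_diff_distrib)
  next
    case power
    let ?a = "\<lambda>n::nat. \<phi> (r \<otimes> g [^] n)"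
    have "foldr (act l) (replicate CHAR('k) GenX) \<phi> r = (act l GenX ^^ CHAR('k)) \<phi> r"
      by (simp add: foldr_replicate)
    also have "\<dots> = (weighted_shift (f r) l ^^ CHAR('k)) ?a 0"
      using act_x_power[OF r, where n = 0 and m = "CHAR('k)"] r by simp
    also have "\<dots> = weighted_shift (f r) l ?a 0"
      using datum_cases[OF r] by (intro weighted_shift_power_CHAR prime_p l) auto
    also have "\<dots> = act l GenX \<phi> r" using r by (simp add: act_GenX weighted_shift_def)
    finally show ?thesis using power by simp
  qed
qed

lemma act_ideal:
  assumes u: "u \<in> ideal_generated (third_type_gens G) (third_type_rels G g f)"
    and l: "l ^ CHAR('k) = l" and r: "r \<in> carrier G"
  shows "lin_ext (*) (\<lambda>w. foldr (act l) w \<phi> r) u = 0"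
proof -
  interpret kvs: vector_space "(*) :: 'k \<Rightarrow> 'k \<Rightarrow> 'k" by (rule vector_space_field)
  let ?A = "lin_ext (*) (\<lambda>w. foldr (act l) w \<phi> r)"
  have gen: "?A (lin_ext fscale (\<lambda>w. fbasis (v @ w @ v')) R) = 0"
    if v: "v \<in> lists (third_type_gens G)" and R: "R \<in> third_type_rels G g f" for v v' R
  proof -
    let ?\<psi> = "foldr (act l) v' \<phi>"
    have "?A (lin_ext fscale (\<lambda>w. fbasis (v @ w @ v')) R)
        = lin_ext (*) (\<lambda>w. foldr (act l) v (foldr (act l) w ?\<psi>) r) R"
      by (subst linear_lin_ext[OF kvs.lin_ext_linear]) simp
    also have "\<dots> = foldr (act l) v (\<lambda>r. lin_ext (*) (\<lambda>w. foldr (act l) w ?\<psi> r) R) r"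
      by (simp add: act_word_lin_ext)
    also have "\<dots> = 0"
      using v r by (intro act_word_zero) (simp_all add: act_rel[OF R l])
    finally show ?thesis .
  qed
  show ?thesis
    using u unfolding ideal_generated_def
  proof (induction rule: fsum.span_induct_alt)
    case (step c a u)
    then show ?case using gen by (auto simp: kvs.lin_ext_add kvs.lin_ext_fscale)
  qed simp
qed

text \<open>
  Applied to the indicator function of \<open>t\<close> and evaluated at \<open>1\<close>, the relation becomes
  \<open>\<Sum>\<^sub>i c\<^sub>i\<^sub>,\<^sub>t l\<^sup>i = 0\<close>.  This polynomial in \<open>l\<close> has degree less than \<open>p\<close> and vanishes at the \<open>p\<close> elements
  of the prime field.
\<close>

lemma basis_independent:
  assumes sum: "(\<Sum>(i, t)\<in>{..<CHAR('k)} \<times> carrier G. scale (c i t) (x ^ i * \<iota> t)) = 0"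
    and i: "i < CHAR('k)" and t: "t \<in> carrier G"
  shows "c i t = 0"
proof -
  interpret kvs: vector_space "(*) :: 'k \<Rightarrow> 'k \<Rightarrow> 'k" by (rule vector_space_field)
  let ?p = "CHAR('k)"
  define u where "u = (\<Sum>(i, t)\<in>{..<?p} \<times> carrier G.
      fscale (c i t) (fbasis (replicate i GenX @ [GenG t])))"
  have "u \<in> formal_sums (lists (third_type_gens G))"
    unfolding u_def
    by (intro fsum.subspace_sum subspace_formal_sums)
      (auto simp: third_type_gens_def intro!: fsum.subspace_scale subspace_formal_sums fbasis_in_formal_sums)
  moreover have "word_eval scale (case_gen \<iota> x) u = 0"
    unfolding word_eval_def u_def using sum
    by (simp add: lin_ext_sum lin_ext_fscale case_prod_unfold prod_list_replicate)
  ultimately have ideal: "u \<in> ideal_generated (third_type_gens G) (third_type_rels G g f)"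
    using presentation by (auto simp: presented_by_def)
  have act_one: "foldr (act l) (replicate j GenX @ [GenG s]) \<phi> \<one> = l ^ j * \<phi> s"
    if "s \<in> carrier G" for l j s \<phi>
    using that by (induction j) (simp_all add: act_GenG act_GenX f_one)
  define P where "P = (\<Sum>j<?p. monom (c j t) j)"
  have "poly P l = 0" if l: "l ^ ?p = l" for l
  proof -
    let ?\<phi> = "\<lambda>s. if s = t then 1 else 0 :: 'k"
    have "0 = lin_ext (*) (\<lambda>w. foldr (act l) w ?\<phi> \<one>) u"
      using act_ideal[OF ideal l] by simp
    also have "\<dots> = (\<Sum>(j, s)\<in>{..<?p} \<times> carrier G. c j s * (l ^ j * ?\<phi> s))"
      unfolding u_def kvs.lin_ext_sum
      by (intro sum.cong refl) (auto simp: kvs.lin_ext_fscale act_one simp del: foldr_append)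
    also have "\<dots> = (\<Sum>j<?p. \<Sum>s\<in>carrier G. if s = t then c j s * l ^ j else 0)"
      by (subst sum.cartesian_product[symmetric]) (intro sum.cong refl, auto)
    also have "\<dots> = poly P l"
      using t finite_G by (simp add: P_def poly_sum poly_monom)
    finally show ?thesis by simp
  qed
  moreover have "degree P < ?p"
    unfolding P_def using CHAR_pos
    by (intro degree_sum_less) (auto intro: le_less_trans[OF degree_monom_le])
  moreover have "card ((of_nat :: nat \<Rightarrow> 'k) ` {..<?p}) = ?p"
    by (simp add: card_image inj_on_of_nat_CHAR)
  ultimately have "P = 0"
    using CHAR_pos of_nat_power_CHAR[OF prime_p]
    by (intro poly_eqI_degree[of "of_nat ` {..<?p}"]) auto
  then have "coeff P i = 0" by simp
  then show ?thesis using i by (simp add: P_def coeff_sum if_distrib cong: if_cong)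
qed

definition pbw :: "nat \<times> 'g \<Rightarrow> 'h" where
  "pbw = (\<lambda>(i, t). x ^ i * \<iota> t)"

lemma finite_pbw_index: "finite ({..<CHAR('k)} \<times> carrier G)"
  by (simp add: finite_G)

lemma pbw_independent:
  assumes "(\<Sum>y\<in>({..<CHAR('k)} \<times> carrier G). scale (c y) (pbw y)) = 0" "y \<in> ({..<CHAR('k)} \<times> carrier G)"
  shows "c y = 0"
  using basis_independent[of "\<lambda>i t. c (i, t)" "fst y" "snd y"] assms
  by (simp add: pbw_def case_prod_unfold mem_Times_iff)

lemma inj_on_pbw: "inj_on pbw ({..<CHAR('k)} \<times> carrier G)"
proof (rule inj_onI, rule ccontr)
  fix a b assume ab: "a \<in> ({..<CHAR('k)} \<times> carrier G)" "b \<in> ({..<CHAR('k)} \<times> carrier G)" "pbw a = pbw b" "a \<noteq> b"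
  let ?c = "\<lambda>y. (if y = a then 1 else 0) - (if y = b then 1 else 0) :: 'k"
  have "(\<Sum>y\<in>({..<CHAR('k)} \<times> carrier G). scale (?c y) (pbw y))
      = (\<Sum>y\<in>({..<CHAR('k)} \<times> carrier G). if y = a then pbw y else 0) - (\<Sum>y\<in>({..<CHAR('k)} \<times> carrier G). if y = b then pbw y else 0)"
    unfolding sum_subtractf[symmetric] by (intro sum.cong) (auto simp: scale_left_diff_distrib)
  also have "\<dots> = 0"
    using ab finite_pbw_index by (simp add: sum.delta del: mem_Sigma_iff)
  finally have "?c a = 0" using ab(1) by (rule pbw_independent)
  then show False using ab(4) by simp
qed

lemma independent_pbw: "independent (pbw ` ({..<CHAR('k)} \<times> carrier G))"
proof (rule independent_if_scalars_zero)
  fix c h assume sum: "(\<Sum>h\<in>pbw ` ({..<CHAR('k)} \<times> carrier G). scale (c h) h) = 0" and h: "h \<in> pbw ` ({..<CHAR('k)} \<times> carrier G)"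
  obtain y where y: "y \<in> ({..<CHAR('k)} \<times> carrier G)" "h = pbw y" using h by blast
  have "(\<Sum>y\<in>({..<CHAR('k)} \<times> carrier G). scale (c (pbw y)) (pbw y)) = 0"
    using sum by (simp add: sum.reindex[OF inj_on_pbw])
  from pbw_independent[OF this y(1)] show "c h = 0" by (simp add: y(2))
qed (simp add: finite_pbw_index)

lemma span_pbw: "span (pbw ` ({..<CHAR('k)} \<times> carrier G)) = UNIV"
  using filt_carrier by (simp add: filt_def pbw_def)

definition coord :: "nat \<Rightarrow> 'g \<Rightarrow> 'h \<Rightarrow> 'k" where
  "coord i t h = representation (pbw ` ({..<CHAR('k)} \<times> carrier G)) h (pbw (i, t))"

lemma linear_coord: "Vector_Spaces.linear scale (*) (coord i t)"
  unfolding coord_def[abs_def] by (rule linear_representation[OF independent_pbw span_pbw])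

lemma coord_zero [simp]: "coord i t 0 = 0"
  and coord_add: "coord i t (a + b) = coord i t a + coord i t b"
  and coord_scale: "coord i t (scale c a) = c * coord i t a"
proof -
  interpret c: Vector_Spaces.linear scale "(*)" "coord i t" by (rule linear_coord)
  show "coord i t 0 = 0" "coord i t (a + b) = coord i t a + coord i t b"
    "coord i t (scale c a) = c * coord i t a"
    by (rule c.zero c.add c.scale)+
qed

lemma coord_basis:
  assumes "i < CHAR('k)" "t \<in> carrier G" "j < CHAR('k)" "s \<in> carrier G"
  shows "coord i t (x ^ j * \<iota> s) = (if i = j \<and> t = s then 1 else 0)"
proof -
  have "(i, t) \<in> ({..<CHAR('k)} \<times> carrier G)" "(j, s) \<in> ({..<CHAR('k)} \<times> carrier G)" using assms by auto
  then have "pbw (i, t) = pbw (j, s) \<longleftrightarrow> i = j \<and> t = s"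
    using inj_on_eq_iff[OF inj_on_pbw] by auto
  moreover have "representation (pbw ` ({..<CHAR('k)} \<times> carrier G)) (pbw (j, s)) = (\<lambda>v. if v = pbw (j, s) then 1 else 0)"
    using assms by (intro representation_basis independent_pbw) auto
  moreover have "x ^ j * \<iota> s = pbw (j, s)" by (simp add: pbw_def)
  ultimately show ?thesis by (simp add: coord_def)
qed

lemma coord_iota:
  assumes "i < CHAR('k)" "t \<in> carrier G" "s \<in> carrier G"
  shows "coord i t (\<iota> s) = (if i = 0 \<and> t = s then 1 else 0)"
  using coord_basis[of i t 0 s] assms CHAR_pos by simp

lemma coord_x_power:
  assumes "i < CHAR('k)" "t \<in> carrier G" "j < CHAR('k)"
  shows "coord i t (x ^ j) = (if i = j \<and> t = \<one> then 1 else 0)"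
  using coord_basis[of i t j \<one>] assms by (simp add: iota_one)

lemma coord_expansion:
  "h = (\<Sum>(i, t)\<in>({..<CHAR('k)} \<times> carrier G). scale (coord i t h) (x ^ i * \<iota> t))"
proof -
  have "h = (\<Sum>b\<in>pbw ` ({..<CHAR('k)} \<times> carrier G). scale (representation (pbw ` ({..<CHAR('k)} \<times> carrier G)) h b) b)"
    by (rule sum_representation_eq[symmetric, OF independent_pbw])
      (simp_all add: span_pbw finite_pbw_index)
  also have "\<dots> = (\<Sum>y\<in>({..<CHAR('k)} \<times> carrier G). scale (representation (pbw ` ({..<CHAR('k)} \<times> carrier G)) h (pbw y)) (pbw y))"
    by (subst sum.reindex[OF inj_on_pbw]) simp
  also have "\<dots> = (\<Sum>(i, t)\<in>({..<CHAR('k)} \<times> carrier G). scale (coord i t h) (x ^ i * \<iota> t))"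
    by (intro sum.cong) (auto simp: coord_def pbw_def)
  finally show ?thesis .
qed

lemma coord_filt:
  assumes h: "h \<in> filt U n" and "n \<le> CHAR('k)" "U \<subseteq> carrier G" "i < CHAR('k)" "t \<in> carrier G"
    and "n \<le> i \<or> t \<notin> U"
  shows "coord i t h = 0"
proof -
  have "subspace {h. coord i t h = 0}"
    by (auto simp: subspace_def coord_add coord_scale)
  then have "filt U n \<subseteq> {h. coord i t h = 0}"
    using assms by (intro filt_minimal) (auto simp: coord_basis)
  then show ?thesis using h by blast
qed

lemma filt_coordI:
  assumes "\<And>i t. i < CHAR('k) \<Longrightarrow> t \<in> carrier G \<Longrightarrow> coord i t h \<noteq> 0 \<Longrightarrow> i < n \<and> t \<in> U"
  shows "h \<in> filt U n"
proof (subst coord_expansion[of h], intro subspace_sum subspace_filt)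
  fix y assume "y \<in> ({..<CHAR('k)} \<times> carrier G)"
  then obtain i t where y: "y = (i, t)" "i < CHAR('k)" "t \<in> carrier G" by auto
  show "(case y of (i, t) \<Rightarrow> scale (coord i t h) (x ^ i * \<iota> t)) \<in> filt U n"
  proof (cases "coord i t h = 0")
    case True
    then show ?thesis using subspace_0 by (simp add: y)
  next
    case False
    then show ?thesis
      using assms[of i t] y by (auto intro!: subspace_scale filt_base)
  qed
qed

lemma iota_in_filt_iff:
  assumes "U \<subseteq> carrier G" "0 < n" "n \<le> CHAR('k)" "t \<in> carrier G"
  shows "\<iota> t \<in> filt U n \<longleftrightarrow> t \<in> U"
proof
  assume "\<iota> t \<in> filt U n"
  then show "t \<in> U"
    using coord_filt[of "\<iota> t" U n 0 t] assms CHAR_pos by (auto simp: coord_iota)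
next
  assume "t \<in> U"
  then show "\<iota> t \<in> filt U n" using filt_base[of 0 n t U] assms by simp
qed

lemma x_notin_filt_1: "U \<subseteq> carrier G \<Longrightarrow> x \<notin> filt U 1"
  using coord_filt[of x U 1 1 \<one>] coord_x_power[of 1 \<one> 1] p_gt_1 by auto

section \<open>Slices of the coproduct\<close>

lemma hit_iota:
  assumes "Vector_Spaces.linear scale (*) \<alpha>" "s \<in> carrier G"
  shows "hit_left \<alpha> (\<iota> s) = scale (\<alpha> (\<iota> s)) (\<iota> s)" "hit_right \<alpha> (\<iota> s) = scale (\<alpha> (\<iota> s)) (\<iota> s)"
  using hit_left_eq[OF assms(1) comult_grp[OF assms(2)]] hit_right_eq[OF assms(1) comult_grp[OF assms(2)]]
  by simp_all

text \<open>
  In \<open>\<Delta>(x\<^sup>i s) = (x \<otimes> 1 + g \<otimes> x)\<^sup>i (s \<otimes> s)\<close> every term other than \<open>x\<^sup>i s \<otimes> s\<close> has a factor \<open>x\<close> on the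
  left of its second component.
\<close>

lemma hit_right_basis:
  assumes \<alpha>: "Vector_Spaces.linear scale (*) \<alpha>" and x0: "\<And>y. \<alpha> (x * y) = 0" and s: "s \<in> carrier G"
  shows "hit_right \<alpha> (x ^ i * \<iota> s) = scale (\<alpha> (\<iota> s)) (x ^ i * \<iota> s)"
proof (induction i)
  case 0
  then show ?case using hit_iota(2)[OF \<alpha> s] by simp
next
  case (Suc i)
  have "hit_right (\<lambda>_. 0) h = 0" for h
    by (simp add: hit_right_def lin_ext_def case_prod_unfold)
  then show ?case
    using hit_mult_split(2)[OF \<alpha> comult_x, of "x ^ i * \<iota> s"] Suc.IH
    by (simp add: x0 mult.assoc scale_mult_right)
qed

lemma coord_0_x_mult:
  assumes "t \<in> carrier G"
  shows "coord 0 t (x * y) = 0"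
proof -
  have "coord 0 t (x * (x ^ i * \<iota> u)) = 0" if "i < CHAR('k)" "u \<in> carrier G" for i u
  proof (cases "Suc i = CHAR('k)")
    case True
    then have "x * (x ^ i * \<iota> u) = x ^ 1 * \<iota> u"
      using x_power_p by (metis mult.assoc power_Suc power_one_right)
    then show ?thesis using coord_basis[of 0 t 1 u] that assms p_gt_1 by simp
  next
    case False
    then show ?thesis using coord_basis[of 0 t "Suc i" u] that assms by (simp add: mult.assoc)
  qed
  moreover have "subspace {y. coord 0 t (x * y) = 0}"
    by (auto simp: subspace_def coord_add coord_scale distrib_left scale_mult_right)
  ultimately have "filt (carrier G) CHAR('k) \<subseteq> {y. coord 0 t (x * y) = 0}"
    by (intro filt_minimal) auto
  then show ?thesis by (auto simp: filt_carrier)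
qed

text \<open>
  The part of \<open>h\<close> that is supported on \<open>t\<close>.
\<close>

definition column :: "'g \<Rightarrow> 'h \<Rightarrow> 'h" where
  "column t h = (\<Sum>i<CHAR('k). scale (coord i t h) (x ^ i * \<iota> t))"

text \<open>
  The functional \<open>coord 0 t\<close> vanishes on \<open>x H\<close>, so slicing with it multiplies \<open>x\<^sup>i s\<close> by its value at \<open>s\<close>.
  As a consequence, Hopf subalgebras are closed under taking columns.
\<close>

lemma hit_right_coord_0:
  assumes t: "t \<in> carrier G"
  shows "hit_right (coord 0 t) h = column t h"
proof -
  interpret r: Vector_Spaces.linear scale scale "hit_right (coord 0 t)"
    by (rule linear_hit_right[OF linear_coord])
  have "hit_right (coord 0 t) h
      = (\<Sum>(i, s)\<in>({..<CHAR('k)} \<times> carrier G). scale (coord i s h) (hit_right (coord 0 t) (x ^ i * \<iota> s)))"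
    by (subst coord_expansion[of h]) (simp add: r.sum r.scale case_prod_unfold)
  also have "\<dots> = (\<Sum>(i, s)\<in>({..<CHAR('k)} \<times> carrier G). if s = t then scale (coord i s h) (x ^ i * \<iota> s) else 0)"
    using t CHAR_pos
    by (intro sum.cong) (auto simp: hit_right_basis[OF linear_coord coord_0_x_mult] coord_iota)
  also have "\<dots> = (\<Sum>i<CHAR('k). \<Sum>s\<in>carrier G. if s = t then scale (coord i s h) (x ^ i * \<iota> s) else 0)"
    by (rule sum.cartesian_product[symmetric])
  also have "\<dots> = column t h"
    using t finite_G by (simp add: column_def)
  finally show ?thesis .
qed

lemma column_in_hopf_subalgebra:
  "hopf_subalgebra scale \<Delta> S C \<Longrightarrow> h \<in> C \<Longrightarrow> t \<in> carrier G \<Longrightarrow> column t h \<in> C"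
  using hit_in_hopf_subalgebra(2)[OF linear_coord] by (simp flip: hit_right_coord_0)

text \<open>
  The first components of \<open>\<Delta>(x\<^sup>i s)\<close> have degree at most \<open>i\<close>, and degree \<open>i\<close> occurs only in
  \<open>x\<^sup>i s \<otimes> s\<close>.
\<close>

lemma hit_left_basis:
  assumes "Vector_Spaces.linear scale (*) \<alpha>" "\<And>y. y \<in> filt (carrier G) i \<Longrightarrow> \<alpha> y = 0" "s \<in> carrier G"
  shows "hit_left \<alpha> (x ^ i * \<iota> s) = scale (\<alpha> (x ^ i * \<iota> s)) (\<iota> s)"
  using assms
proof (induction i arbitrary: \<alpha>)
  case 0
  then show ?case using hit_iota(1) by simp
next
  case (Suc i)
  let ?h = "x ^ i * \<iota> s"
  have "hit_left (\<lambda>c. \<alpha> (x * c)) ?h = scale (\<alpha> (x * ?h)) (\<iota> s)"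
    using Suc.prems by (intro Suc.IH linear_compose_mult) (auto intro: x_mult_filt)
  moreover have "hit_left (\<lambda>c. \<alpha> (\<iota> g * c)) ?h = scale (\<alpha> (\<iota> g * ?h)) (\<iota> s)"
    using Suc.prems filt_mono[of i "Suc i" "carrier G" "carrier G"]
    by (intro Suc.IH linear_compose_mult) (auto intro: iota_mult_filt[of _ "carrier G"])
  moreover have "\<iota> g * ?h \<in> filt (carrier G) (Suc i)"
    using Suc.prems(3) by (intro iota_mult_filt[of _ "carrier G"] filt_base) auto
  ultimately show ?case
    using hit_mult_split(1)[OF Suc.prems(1) comult_x, of ?h] Suc.prems(2)
    by (simp add: mult.assoc)
qed

text \<open>
  One degree below the top, the second component is \<open>1\<close> or \<open>x\<close>: the terms of \<open>(x \<otimes> 1 + g \<otimes> x)\<^sup>m\<^sup>+\<^sup>1\<close> whose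
  first component has degree at least \<open>m\<close> are \<open>x\<^sup>m\<^sup>+\<^sup>1 \<otimes> 1\<close> and the \<open>x\<^sup>a g x\<^sup>m\<^sup>-\<^sup>a \<otimes> x\<close>.
\<close>

lemma hit_left_x_power:
  assumes "Vector_Spaces.linear scale (*) \<alpha>" "\<And>y. y \<in> filt (carrier G) m \<Longrightarrow> \<alpha> y = 0"
  shows "hit_left \<alpha> (x ^ Suc m)
    = scale (\<alpha> (x ^ Suc m)) 1 + scale (\<Sum>a\<le>m. \<alpha> (x ^ a * (\<iota> g * x ^ (m - a)))) x"
  using assms
proof (induction m arbitrary: \<alpha>)
  case 0
  have "hit_left \<beta> 1 = scale (\<beta> 1) 1" if "Vector_Spaces.linear scale (*) \<beta>" for \<beta>
    using hit_iota(1)[OF that one_closed] by (simp add: iota_one)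
  then show ?case
    using hit_mult_split(1)[OF 0(1) comult_x, of 1] linear_compose_mult[OF 0(1)]
    by (simp add: scale_mult_right)
next
  case (Suc m)
  have "hit_left (\<lambda>c. \<alpha> (x * c)) (x ^ Suc m) = scale (\<alpha> (x * x ^ Suc m)) 1
      + scale (\<Sum>a\<le>m. \<alpha> (x * (x ^ a * (\<iota> g * x ^ (m - a))))) x"
    using Suc.prems by (intro Suc.IH linear_compose_mult) (auto intro: x_mult_filt)
  moreover have "hit_left (\<lambda>c. \<alpha> (\<iota> g * c)) (x ^ Suc m * \<iota> \<one>)
      = scale (\<alpha> (\<iota> g * (x ^ Suc m * \<iota> \<one>))) (\<iota> \<one>)"
    using Suc.prems
    by (intro hit_left_basis linear_compose_mult) (auto intro: iota_mult_filt[of _ "carrier G"])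
  ultimately have "hit_left \<alpha> (x * x ^ Suc m) = scale (\<alpha> (x * x ^ Suc m)) 1
      + scale (\<alpha> (\<iota> g * x ^ Suc m) + (\<Sum>a\<le>m. \<alpha> (x * (x ^ a * (\<iota> g * x ^ (m - a)))))) x"
    using hit_mult_split(1)[OF Suc.prems(1) comult_x, of "x ^ Suc m"]
    by (simp add: iota_one scale_mult_right scale_left_distrib add_ac del: power_Suc)
  moreover have "(\<Sum>a\<le>Suc m. \<alpha> (x ^ a * (\<iota> g * x ^ (Suc m - a))))
      = \<alpha> (\<iota> g * x ^ Suc m) + (\<Sum>a\<le>m. \<alpha> (x * (x ^ a * (\<iota> g * x ^ (m - a)))))"
    by (subst sum.atMost_Suc_shift) (simp add: mult.assoc)
  ultimately show ?case by simp
qed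

text \<open>
  Moving \<open>g\<close> to the right changes the element only in degrees less than \<open>a + b\<close>.
\<close>

lemma coord_sandwich:
  assumes "a + b < CHAR('k)"
  shows "coord (a + b) g (x ^ a * (\<iota> g * x ^ b)) = 1"
proof -
  have "\<iota> g * (x ^ b * \<iota> \<one>) - x ^ b * \<iota> (g \<otimes> \<one>) \<in> filt (carrier G) b"
    by (rule iota_mult_basis) auto
  then have "\<iota> g * x ^ b - x ^ b * \<iota> g \<in> filt (carrier G) b"
    by (simp add: iota_one)
  then have "x ^ a * (\<iota> g * x ^ b - x ^ b * \<iota> g) \<in> filt (carrier G) (a + b)"
    by (induction a) (simp_all add: mult.assoc x_mult_filt)
  then have "coord (a + b) g (x ^ a * (\<iota> g * x ^ b - x ^ b * \<iota> g)) = 0"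
    using assms by (intro coord_filt) auto
  moreover have "x ^ a * (\<iota> g * x ^ b) = x ^ a * (\<iota> g * x ^ b - x ^ b * \<iota> g) + x ^ (a + b) * \<iota> g"
    by (simp add: right_diff_distrib power_add mult.assoc)
  ultimately show ?thesis
    using coord_basis[of "a + b" g "a + b" g] assms by (simp add: coord_add)
qed

text \<open>
  Let \<open>n\<close> be the degree of the column of \<open>h\<close> at \<open>t\<close>.  Slicing the column with \<open>coord n t\<close> leaves its
  leading coefficient times \<open>t\<close>.  Then the column can be multiplied by the inverse of \<open>t\<close>, and if
  \<open>n > 0\<close>, slicing the result with \<open>coord (n - 1) g\<close> leaves \<open>n\<close> times the leading coefficient times \<open>x\<close>:
  the group component \<open>g \<noteq> 1\<close> of the functional discards the terms \<open>x\<^sup>i \<otimes> 1\<close>.  Finally \<open>n\<close> is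
  invertible because \<open>n < p\<close>.
\<close>

lemma iota_in_hopf_subalgebra:
  assumes C: "hopf_subalgebra scale \<Delta> S C" and h: "h \<in> C"
    and i: "i < CHAR('k)" and t: "t \<in> carrier G" and ne: "coord i t h \<noteq> 0"
  shows "\<iota> t \<in> C" and "0 < i \<Longrightarrow> x \<in> C"
proof -
  let ?p = "CHAR('k)"
  have sub: "subspace C" and mult: "\<And>a b. a \<in> C \<Longrightarrow> b \<in> C \<Longrightarrow> a * b \<in> C"
    using C by (auto simp: hopf_subalgebra_def)
  define n where "n = Max {i. i < ?p \<and> coord i t h \<noteq> 0}"
  have n_max: "i \<le> n" if "i < ?p" "coord i t h \<noteq> 0" for i
    unfolding n_def using that by (intro Max_ge) auto
  have "n \<in> {i. i < ?p \<and> coord i t h \<noteq> 0}"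
    unfolding n_def using i ne by (intro Max_in) auto
  then have n: "n < ?p" "coord n t h \<noteq> 0" by auto
  have "coord i t h = 0" if "i < ?p" "\<not> i \<le> n" for i
    using n_max that by blast
  then have col: "column t h = (\<Sum>i\<le>n. scale (coord i t h) (x ^ i * \<iota> t))"
    unfolding column_def using n(1) by (intro sum.mono_neutral_right) auto
  have colC: "column t h \<in> C" by (rule column_in_hopf_subalgebra[OF C h t])
  interpret l: Vector_Spaces.linear scale scale "hit_left (coord n t)"
    by (rule linear_hit_left[OF linear_coord])
  have "hit_left (coord n t) (column t h) = (\<Sum>i\<le>n. scale (coord i t h * coord n t (x ^ i * \<iota> t)) (\<iota> t))"
    unfolding col l.sum l.scale using n(1) t
    by (intro sum.cong refl, subst hit_left_basis[OF linear_coord])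
      (auto intro: coord_filt[of _ "carrier G"])
  also have "\<dots> = (\<Sum>i\<le>n. if i = n then scale (coord i t h) (\<iota> t) else 0)"
    using n(1) t by (intro sum.cong) (auto simp: coord_basis)
  also have "\<dots> = scale (coord n t h) (\<iota> t)" by simp
  finally have "scale (coord n t h) (\<iota> t) \<in> C"
    using hit_in_hopf_subalgebra(1)[OF linear_coord C colC] by metis
  from subspace_scale[OF sub this, of "inverse (coord n t h)"]
  show tC: "\<iota> t \<in> C" using n(2) by simp
  show "x \<in> C" if i_pos: "0 < i"
  proof -
    obtain m where m: "n = Suc m" using n_max[OF i ne] i_pos by (cases n) auto
    interpret lm: Vector_Spaces.linear scale scale "hit_left (coord m g)"
      by (rule linear_hit_left[OF linear_coord])
    have "\<iota> (inv t) \<in> C" using tC C t antipode_grp by (auto simp: hopf_subalgebra_def)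
    from mult[OF colC this] have "(\<Sum>i\<le>n. scale (coord i t h) (x ^ i)) \<in> C"
      using t by (simp add: col sum_distrib_right scale_mult_left mult.assoc iota_one flip: iota_mult)
    then have "hit_left (coord m g) (\<Sum>i\<le>n. scale (coord i t h) (x ^ i)) \<in> C"
      by (rule hit_in_hopf_subalgebra(1)[OF linear_coord C])
    \<comment> \<open>In degree \<open>m\<close> the first components of \<open>\<Delta>(x\<^sup>i)\<close> contain at most \<open>x\<^sup>m\<close>, with group component \<open>1 \<noteq> g\<close>.\<close>
    moreover have "hit_left (coord m g) (x ^ i) = 0" if "i \<le> m" for i
    proof -
      have "hit_left (coord m g) (x ^ i * \<iota> \<one>) = scale (coord m g (x ^ i * \<iota> \<one>)) (\<iota> \<one>)"
        using that n(1) m by (intro hit_left_basis linear_coord coord_filt[of _ "carrier G"]) auto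
      then show ?thesis using that n(1) m g_neq_one by (simp add: iota_one coord_x_power)
    qed
    moreover have "hit_left (coord m g) (x ^ Suc m) = scale (of_nat (Suc m)) x"
    proof -
      have "(\<Sum>a\<le>m. coord m g (x ^ a * (\<iota> g * x ^ (m - a)))) = (\<Sum>a\<le>m. 1)"
        using coord_sandwich[of _ "m - _"] n(1) m
        by (intro sum.cong refl) (metis Suc_lessD atMost_iff le_add_diff_inverse)
      moreover have "coord m g (x ^ Suc m) = 0"
        using n(1) m by (subst coord_x_power) auto
      moreover have "coord m g y = 0" if "y \<in> filt (carrier G) m" for y
        using that n(1) m by (intro coord_filt[of _ "carrier G"]) auto
      ultimately show ?thesis
        using hit_left_x_power[OF linear_coord, of m m g] by simp
    qed
    ultimately have scaled: "scale (coord n t h * of_nat n) x \<in> C"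
      by (simp add: lm.add lm.sum lm.scale m)
    moreover have "(of_nat n :: 'k) \<noteq> 0"
      unfolding of_nat_eq_0_iff_char_dvd using n(1) m by (auto dest: dvd_imp_le)
    ultimately have "scale (inverse (coord n t h * of_nat n)) (scale (coord n t h * of_nat n) x) = x"
      using n(2) by (simp only: scale_scale) (simp add: field_simps)
    then show ?thesis using subspace_scale[OF sub scaled] by metis
  qed
qed

text \<open>
  Slice \<open>\<Delta> x = x \<otimes> 1 + g \<otimes> x\<close> on the right with the coordinate of \<open>x\<close>.
\<close>

lemma g_in_hopf_subalgebra:
  assumes C: "hopf_subalgebra scale \<Delta> S C" and "x \<in> C"
  shows "\<iota> g \<in> C"
proof -
  have "hit_right (coord 1 \<one>) x = \<iota> g"
    using hit_right_eq[OF linear_coord comult_x, of 1 \<one>] p_gt_1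
      coord_x_power[of 1 \<one> 1] coord_x_power[of 1 \<one> 0]
    by (simp add: lin_ext_add)
  then show ?thesis using hit_in_hopf_subalgebra(2)[OF linear_coord C assms(2)] by metis
qed

section \<open>Classification of the Hopf subalgebras\<close>

definition grouplikes :: "'h set \<Rightarrow> 'g set" where
  "grouplikes C = {t \<in> carrier G. \<iota> t \<in> C}"

lemma group_algebra_filt: "group_algebra_sub scale \<iota> U = filt U 1"
  unfolding group_algebra_sub_def filt_def by (rule arg_cong[of _ _ span]) force

lemma subgroup_grouplikes:
  assumes C: "hopf_subalgebra scale \<Delta> S C"
  shows "subgroup (grouplikes C) G"
proof
  show "grouplikes C \<subseteq> carrier G" by (auto simp: grouplikes_def)
  show "s \<otimes> t \<in> grouplikes C" if "s \<in> grouplikes C" "t \<in> grouplikes C" for s t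
    using that C by (auto simp: grouplikes_def hopf_subalgebra_def iota_mult)
  show "\<one> \<in> grouplikes C"
    using C by (auto simp: grouplikes_def hopf_subalgebra_def iota_one)
  show "inv t \<in> grouplikes C" if "t \<in> grouplikes C" for t
    using that C antipode_grp[of t] by (auto simp: grouplikes_def hopf_subalgebra_def)
qed

lemma filt_subset_hopf_subalgebra:
  assumes C: "hopf_subalgebra scale \<Delta> S C" and "x \<in> C \<or> n \<le> 1" and "\<iota> ` U \<subseteq> C"
  shows "filt U n \<subseteq> C"
proof (rule filt_minimal)
  have one: "1 \<in> C" and mult: "\<And>a b. a \<in> C \<Longrightarrow> b \<in> C \<Longrightarrow> a * b \<in> C"
    using C by (auto simp: hopf_subalgebra_def)
  show "subspace C" using C by (simp add: hopf_subalgebra_def)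
  have "x ^ i \<in> C" if "x \<in> C" for i
    using that by (induction i) (auto intro: one mult)
  then show "x ^ i * \<iota> u \<in> C" if "i < n" "u \<in> U" for i u
    using that assms(2,3) by (cases "i = 0") (auto intro: mult)
qed

text \<open>
  Every \<open>t\<close> that occurs in an element of \<open>C\<close> lies in \<open>C\<close>, and positive powers of \<open>x\<close> occur only if \<open>x\<close>
  lies in \<open>C\<close>.
\<close>

theorem hopf_subalgebra_classification:
  assumes C: "hopf_subalgebra scale \<Delta> S C"
  shows "x \<in> C \<Longrightarrow> g \<in> grouplikes C \<and> C = filt (grouplikes C) CHAR('k)"
    and "x \<notin> C \<Longrightarrow> C = filt (grouplikes C) 1"
proof -
  have iota: "\<iota> ` grouplikes C \<subseteq> C" by (auto simp: grouplikes_def)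
  assume x: "x \<in> C"
  have "C \<subseteq> filt (grouplikes C) CHAR('k)"
    using iota_in_hopf_subalgebra(1)[OF C] by (auto intro!: filt_coordI simp: grouplikes_def)
  then show "g \<in> grouplikes C \<and> C = filt (grouplikes C) CHAR('k)"
    using filt_subset_hopf_subalgebra[OF C _ iota] x g_in_hopf_subalgebra[OF C x]
    by (auto simp: grouplikes_def)
next
  have iota: "\<iota> ` grouplikes C \<subseteq> C" by (auto simp: grouplikes_def)
  assume x: "x \<notin> C"
  have "C \<subseteq> filt (grouplikes C) 1"
    using iota_in_hopf_subalgebra[OF C] x
    by (auto intro!: filt_coordI simp: grouplikes_def) (metis gr0I)
  then show "C = filt (grouplikes C) 1"
    using filt_subset_hopf_subalgebra[OF C _ iota] by blast
qed

lemma filt_mult_closed: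
  assumes K: "subgroup K G" and g: "g \<in> K"
    and a: "a \<in> filt K CHAR('k)" and b: "b \<in> filt K CHAR('k)"
  shows "a * b \<in> filt K CHAR('k)"
proof -
  have "x ^ i * \<iota> u * b \<in> filt K CHAR('k)" if "u \<in> K" for i u
    using that K g b
    by (simp add: mult.assoc)
      (intro x_power_mult_filt_p iota_mult_filt[of _ K]; auto intro: subgroup.m_closed subgroup.mem_carrier)
  then have "filt K CHAR('k) \<subseteq> {a. a * b \<in> filt K CHAR('k)}"
    by (intro filt_minimal) (auto simp: subspace_right_mult_preimage)
  then show ?thesis using a by blast
qed

text \<open>
  The term \<open>x\<^sup>i s \<otimes> s\<close> is split off because the remaining first components have smaller degree.  This
  triangular shape is what allows the antipode to be computed recursively.
\<close>

lemma comult_basis: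
  assumes K: "subgroup K G" and g: "g \<in> K" and s: "s \<in> K"
  shows "\<exists>u\<in>formal_sums (filt K i \<times> filt K CHAR('k)).
    tensor_eq scale (\<Delta> (x ^ i * \<iota> s)) (fbasis (x ^ i * \<iota> s, \<iota> s) + u)"
proof (induction i)
  case 0
  have "tensor_eq scale (\<Delta> (x ^ 0 * \<iota> s)) (fbasis (x ^ 0 * \<iota> s, \<iota> s) + 0)"
    using comult_grp[of s] s K by (simp add: subgroup.mem_carrier)
  then show ?case using fsum.subspace_0[OF subspace_formal_sums] by blast
next
  case (Suc i)
  let ?h = "x ^ i * \<iota> s" and ?F = "formal_sums (filt K (Suc i) \<times> filt K CHAR('k))"
  obtain u where u: "u \<in> formal_sums (filt K i \<times> filt K CHAR('k))"
    "tensor_eq scale (\<Delta> ?h) (fbasis (?h, \<iota> s) + u)" using Suc.IH by blast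
  have gK: "\<iota> g * y \<in> filt K n" if "y \<in> filt K n" for y n
    using that K g by (intro iota_mult_filt[of _ K]) (auto intro: subgroup.m_closed subgroup.mem_carrier)
  have up: "filt K i \<subseteq> filt K (Suc i)" by (rule filt_mono) auto
  let ?v = "tensor_lmult x 1 u + fbasis (\<iota> g * ?h, x * \<iota> s) + tensor_lmult (\<iota> g) x u"
  have "tensor_eq scale (\<Delta> (x * ?h))
      (tensor_lmult x 1 (fbasis (?h, \<iota> s) + u) + tensor_lmult (\<iota> g) x (fbasis (?h, \<iota> s) + u))"
    by (rule comult_mult_split[OF comult_x u(2)])
  then have "tensor_eq scale (\<Delta> (x * ?h)) (fbasis (x * ?h, \<iota> s) + ?v)"
    by (simp add: tensor_lmult_def fsum.lin_ext_add add_ac)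
  moreover have "?v \<in> ?F"
  proof (intro fsum.subspace_add subspace_formal_sums)
    show "tensor_lmult x 1 u \<in> ?F"
      using u(1) by (rule tensor_lmult_formal_sums) (auto intro: x_mult_filt)
    show "tensor_lmult (\<iota> g) x u \<in> ?F"
      using u(1) by (rule tensor_lmult_formal_sums) (use up in \<open>auto intro: gK x_mult_filt_p\<close>)
    show "fbasis (\<iota> g * ?h, x * \<iota> s) \<in> ?F"
      using s filt_base[of 0 "CHAR('k)" s K] CHAR_pos
      by (intro fbasis_in_formal_sums SigmaI gK filt_base x_mult_filt_p) auto
  qed
  ultimately show ?case by (auto simp: mult.assoc)
qed

text \<open>
  Stability under the antipode is the point that needs an argument.  By the shape of \<open>\<Delta>(x\<^sup>i s)\<close>, the axiom
  \<open>\<Sum> S(h\<^sub>1) h\<^sub>2 = \<epsilon>(h) 1\<close> expresses \<open>S(x\<^sup>i s) s\<close> through values of \<open>S\<close> at elements of smaller degree, so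
  induction on the degree applies without knowing that \<open>S\<close> is antimultiplicative.
\<close>

theorem hopf_subalgebra_filt:
  assumes K: "subgroup K G" and g: "g \<in> K"
  shows "hopf_subalgebra scale \<Delta> S (filt K CHAR('k))"
  unfolding hopf_subalgebra_def
proof (intro conjI ballI)
  let ?W = "filt K CHAR('k)"
  interpret S: Vector_Spaces.linear scale scale S by (rule antipode_linear)
  note mult = filt_mult_closed[OF K g]
  have iota: "\<iota> s \<in> ?W" if "s \<in> K" for s
    using filt_base[of 0 "CHAR('k)" s K] that CHAR_pos by simp
  show "subspace ?W" by simp
  show "1 \<in> ?W" using iota[of \<one>] K by (simp add: iota_one subgroup.one_closed)
  show "a * b \<in> ?W" if "a \<in> ?W" "b \<in> ?W" for a b using that by (rule mult)
  show "\<exists>u\<in>formal_sums (?W \<times> ?W). tensor_eq scale (\<Delta> b) u" if "b \<in> ?W" for b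
  proof (rule comult_span_closed[OF subspace_filt _ that[unfolded filt_def]])
    fix h assume "h \<in> (\<lambda>(i, u). x ^ i * \<iota> u) ` ({..<CHAR('k)} \<times> K)"
    then obtain i s where h: "h = x ^ i * \<iota> s" "i < CHAR('k)" "s \<in> K" by auto
    obtain u where u: "u \<in> formal_sums (filt K i \<times> ?W)" "tensor_eq scale (\<Delta> h) (fbasis (h, \<iota> s) + u)"
      using comult_basis[OF K g h(3), of i] h(1) by blast
    have "filt K i \<times> ?W \<subseteq> ?W \<times> ?W" using filt_mono[of i "CHAR('k)" K K] h(2) by auto
    then have "u \<in> formal_sums (?W \<times> ?W)" using u(1) formal_sums_mono by blast
    moreover have "fbasis (h, \<iota> s) \<in> formal_sums (?W \<times> ?W)"
      using h by (intro fbasis_in_formal_sums) (auto intro: filt_base iota)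
    ultimately show "\<exists>u\<in>formal_sums (?W \<times> ?W). tensor_eq scale (\<Delta> h) u"
      using u(2) fsum.subspace_add[OF subspace_formal_sums] by blast
  qed
  have "S h \<in> ?W" if "i \<le> CHAR('k)" "h \<in> filt K i" for i h
    using that
  proof (induction i arbitrary: h)
    case 0
    then show ?case using subspace_0[OF subspace_filt] by (simp add: filt_def S.zero)
  next
    case (Suc i)
    have gen: "S (x ^ i * \<iota> s) \<in> ?W" if s: "s \<in> K" for s
    proof -
      let ?h = "x ^ i * \<iota> s"
      obtain u where u: "u \<in> formal_sums (filt K i \<times> ?W)"
        "tensor_eq scale (\<Delta> ?h) (fbasis (?h, \<iota> s) + u)"
        using comult_basis[OF K g s, of i] by blast
      let ?r = "lin_ext scale (\<lambda>(b, c). S b * c) u"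
      have "?r \<in> ?W"
        using u(1) Suc.prems(1)
        by (intro lin_ext_in_subspace subspace_filt) (auto simp: formal_sums_def intro!: mult Suc.IH)
      moreover have "S ?h * \<iota> s + ?r = scale (\<epsilon> ?h) 1"
        using antipode_left[of ?h] bilinear_tensor_eq[OF vector_space_axioms antipode_bilinear u(2)]
        by (simp add: lin_ext_add)
      then have "S ?h * \<iota> s = scale (\<epsilon> ?h) 1 - ?r" by (simp add: eq_diff_eq)
      ultimately have "S ?h * \<iota> s \<in> ?W"
        using \<open>1 \<in> ?W\<close> by (simp add: subspace_diff subspace_scale)
      from mult[OF this iota[OF subgroup.m_inv_closed[OF K s]]] show ?thesis
        using subgroup.mem_carrier[OF K s] by (simp add: mult.assoc iota_one flip: iota_mult)
    qed
    have "filt K (Suc i) \<subseteq> {h. S h \<in> ?W}"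
    proof (rule filt_minimal)
      show "subspace {h. S h \<in> ?W}" by (rule S.subspace_linear_preimage) simp
      fix j s assume "j < Suc i" "s \<in> K"
      then show "x ^ j * \<iota> s \<in> {h. S h \<in> ?W}"
        using gen Suc.IH[OF _ filt_base[of j i s K]] Suc.prems(1) by (cases "j = i") auto
    qed
    then show ?case using Suc.prems(2) by blast
  qed
  then show "S b \<in> ?W" if "b \<in> ?W" for b using that by blast
qed

lemma hopf_subalgebra_filt_1:
  assumes K: "subgroup K G"
  shows "hopf_subalgebra scale \<Delta> S (filt K 1)"
  unfolding hopf_subalgebra_def
proof (intro conjI ballI)
  interpret S: Vector_Spaces.linear scale scale S by (rule antipode_linear)
  have iota: "\<iota> s \<in> filt K 1" if "s \<in> K" for s
    using filt_base[of 0 1 s K] that by simp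
  show "subspace (filt K 1)" by simp
  show "1 \<in> filt K 1" using iota[of \<one>] K by (simp add: iota_one subgroup.one_closed)
  have gen_mult: "\<iota> s * b \<in> filt K 1" if "s \<in> K" "b \<in> filt K 1" for s b
  proof -
    have "filt K 1 \<subseteq> {b. \<iota> s * b \<in> filt K 1}"
      using that K iota by (intro filt_minimal)
        (auto simp: subspace_left_mult_preimage subgroup.mem_carrier subgroup.m_closed
          simp flip: iota_mult)
    then show ?thesis using that by blast
  qed
  show "a * b \<in> filt K 1" if "a \<in> filt K 1" "b \<in> filt K 1" for a b
  proof -
    have "filt K 1 \<subseteq> {a. a * b \<in> filt K 1}"
      using that gen_mult by (intro filt_minimal) (auto simp: subspace_right_mult_preimage)
    then show ?thesis using that by blast
  qed
  show "\<exists>u\<in>formal_sums (filt K 1 \<times> filt K 1). tensor_eq scale (\<Delta> b) u" if "b \<in> filt K 1" for b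
  proof (rule comult_span_closed[OF subspace_filt _ that[unfolded filt_def]])
    fix h assume "h \<in> (\<lambda>(i, u). x ^ i * \<iota> u) ` ({..<1} \<times> K)"
    then obtain s where h: "h = \<iota> s" "s \<in> K" by auto
    then show "\<exists>u\<in>formal_sums (filt K 1 \<times> filt K 1). tensor_eq scale (\<Delta> h) u"
      using comult_grp[of s] K
      by (intro bexI[of _ "fbasis (\<iota> s, \<iota> s)"] fbasis_in_formal_sums)
        (auto intro: iota[unfolded One_nat_def] subgroup.mem_carrier)
  qed
  show "S b \<in> filt K 1" if "b \<in> filt K 1" for b
  proof -
    have "filt K 1 \<subseteq> {b. S b \<in> filt K 1}"
      using K antipode_grp iota by (intro filt_minimal S.subspace_linear_preimage subspace_filt)
        (auto simp: subgroup.mem_carrier subgroup.m_inv_closed)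
    then show ?thesis using that by blast
  qed
qed

lemma third_type_sub_filt:
  assumes K: "subgroup K G" and g: "g \<in> K"
  shows "third_type_sub scale \<Delta> S \<iota> x K = filt K CHAR('k)"
proof
  have "x ^ 1 * \<iota> \<one> \<in> filt K CHAR('k)"
    using K p_gt_1 by (intro filt_base subgroup.one_closed)
  then have "x \<in> filt K CHAR('k)" by (simp add: iota_one)
  moreover have "\<iota> ` K \<subseteq> filt K CHAR('k)"
    using filt_base[of 0 "CHAR('k)" _ K] CHAR_pos by auto
  ultimately show "third_type_sub scale \<Delta> S \<iota> x K \<subseteq> filt K CHAR('k)"
    unfolding third_type_sub_def hopf_generated_def using hopf_subalgebra_filt[OF assms] by blast
  show "filt K CHAR('k) \<subseteq> third_type_sub scale \<Delta> S \<iota> x K"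
    unfolding third_type_sub_def hopf_generated_def using filt_subset_hopf_subalgebra by blast
qed

section \<open>Exact factorizations of \<open>H\<close> and of \<open>G\<close>\<close>

lemma x_in_filt_p: "subgroup K G \<Longrightarrow> x \<in> filt K CHAR('k)"
  using filt_base[OF p_gt_1, of \<one> K] by (simp add: iota_one subgroup.one_closed)

text \<open>
  Since \<open>x\<close> stands on the left in the basis, \<open>(x\<^sup>i u) c = x\<^sup>i (u c)\<close> is again a basis element, and each basis
  element arises in this way from a unique pair \<open>(u, c)\<close>.
\<close>

lemma exact_factorization_filt:
  assumes "(K, \<Gamma>) \<in> group_exact_factorizations G g"
  shows "exact_factorization scale (filt K CHAR('k)) (filt \<Gamma> 1)"
proof -
  have K: "subgroup K G" and \<Gamma>: "subgroup \<Gamma> G" and prod: "carrier G = K <#> \<Gamma>" and int: "K \<inter> \<Gamma> = {\<one>}"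
    using assms by (auto simp: group_exact_factorizations_def)
  note KG = subgroup.mem_carrier[OF K] subgroup.mem_carrier[OF \<Gamma>]
  have ex: "\<exists>y. y \<in> K \<times> \<Gamma> \<and> fst y \<otimes> snd y = s" if "s \<in> carrier G" for s
    using that unfolding prod set_mult_def by force
  \<comment> \<open>The factors of \<open>s\<close> in \<open>G = K \<Gamma>\<close>; they are unique by \<open>dec_mult\<close>.\<close>
  define dec where "dec s = (SOME y. y \<in> K \<times> \<Gamma> \<and> fst y \<otimes> snd y = s)" for s
  have dec: "dec s \<in> K \<times> \<Gamma>" "fst (dec s) \<otimes> snd (dec s) = s" if "s \<in> carrier G" for s
    using someI_ex[OF ex[OF that]] by (simp_all add: dec_def)
  have dec_mult: "dec (k \<otimes> c) = (k, c)" if kc: "k \<in> K" "c \<in> \<Gamma>" for k c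
  proof -
    obtain k' c' where d: "dec (k \<otimes> c) = (k', c')" by (cases "dec (k \<otimes> c)")
    then have k'c': "k' \<in> K" "c' \<in> \<Gamma>" "k' \<otimes> c' = k \<otimes> c"
      using dec[of "k \<otimes> c"] kc KG by auto
    have eq: "inv k' \<otimes> k = c' \<otimes> inv c"
      using k'c' kc KG by (metis inv_closed inv_solve_left inv_solve_right m_assoc m_closed)
    have "inv k' \<otimes> k \<in> K" "c' \<otimes> inv c \<in> \<Gamma>"
      using k'c' kc K \<Gamma> by (auto intro: subgroup.m_closed subgroup.m_inv_closed)
    then have "inv k' \<otimes> k = \<one>" "c' \<otimes> inv c = \<one>" using eq int by auto
    then have "k = k'" "c' = c"
      using k'c' kc KG by (metis inv_equality inv_inv inv_closed, metis inv_equality inv_inv inv_closed)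
    then show ?thesis using d by simp
  qed
  define X where "X = (\<lambda>(i, u). x ^ i * \<iota> u) ` ({..<CHAR('k)} \<times> K)"
  define Y where "Y = (\<lambda>(i, u). x ^ i * \<iota> u) ` ({..<1} \<times> \<Gamma>)"
  define \<sigma> where "\<sigma> h = (\<Sum>(i, s)\<in>{..<CHAR('k)} \<times> carrier G.
      fscale (coord i s h) (fbasis (x ^ i * \<iota> (fst (dec s)), \<iota> (snd (dec s)))))" for h
  have "exact_factorization scale (span X) (span Y)"
  proof (rule exact_factorization_sectionI)
    show "Vector_Spaces.linear scale fscale \<sigma>"
      unfolding Vector_Spaces.linear_iff \<sigma>_def
      by (simp add: vector_space_axioms vector_space_fscale coord_add coord_scale case_prod_unfold
          fsum.scale_left_distrib sum.distrib fsum.scale_sum_right)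
    fix a b assume "a \<in> X" "b \<in> Y"
    then obtain i k c where ab: "a = x ^ i * \<iota> k" "b = \<iota> c" "i < CHAR('k)" "k \<in> K" "c \<in> \<Gamma>"
      by (auto simp: X_def Y_def)
    have "a * b = x ^ i * \<iota> (k \<otimes> c)" using ab KG by (simp add: iota_mult mult.assoc)
    then have "\<sigma> (a * b) = (\<Sum>y\<in>{..<CHAR('k)} \<times> carrier G. if y = (i, k \<otimes> c) then fbasis (a, b) else 0)"
      unfolding \<sigma>_def using ab KG by (intro sum.cong) (auto simp: coord_basis dec_mult split: if_splits)
    also have "\<dots> = fbasis (a, b)" using ab KG finite_G by (simp add: sum.delta)
    finally show "\<sigma> (a * b) = fbasis (a, b)" .
  next
    have "filt (carrier G) CHAR('k) \<subseteq> span ((\<lambda>(a, b). a * b) ` (X \<times> Y))"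
    proof (rule filt_minimal)
      fix i s assume i: "i < CHAR('k)" and s: "s \<in> carrier G"
      let ?k = "fst (dec s)" and ?c = "snd (dec s)"
      have kc: "?k \<in> K" "?c \<in> \<Gamma>" "s = ?k \<otimes> ?c" using dec[OF s] by auto
      have "\<iota> s = \<iota> ?k * \<iota> ?c"
        using arg_cong[OF kc(3), of \<iota>] iota_mult[of ?k ?c] kc(1,2) KG by simp
      then have "x ^ i * \<iota> s = x ^ i * \<iota> ?k * \<iota> ?c" by (simp add: mult.assoc)
      moreover have "x ^ i * \<iota> ?k \<in> X"
        using i kc unfolding X_def by (intro image_eqI[of _ _ "(i, ?k)"]) auto
      moreover have "\<iota> ?c \<in> Y"
        using kc unfolding Y_def by (intro image_eqI[of _ _ "(0, ?c)"]) auto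
      ultimately show "x ^ i * \<iota> s \<in> span ((\<lambda>(a, b). a * b) ` (X \<times> Y))"
        by (intro span_base image_eqI[of _ _ "(x ^ i * \<iota> ?k, \<iota> ?c)"]) auto
    qed simp
    then show "span ((\<lambda>(a, b). a * b) ` (X \<times> Y)) = UNIV" by (simp add: filt_carrier top.extremum_unique)
  qed
  then show ?thesis by (simp add: filt_def X_def Y_def)
qed

lemma filt_p_eq_UNIV_iff:
  assumes "U \<subseteq> carrier G"
  shows "filt U CHAR('k) = UNIV \<longleftrightarrow> U = carrier G"
proof
  assume "filt U CHAR('k) = UNIV"
  then show "U = carrier G" using iota_in_filt_iff[OF assms CHAR_pos le_refl] assms by blast
qed (simp add: filt_carrier)

lemma proper_exact_factorization_of_groups:
  assumes "(K, \<Gamma>) \<in> group_exact_factorizations G g"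
  shows "(filt K CHAR('k), filt \<Gamma> 1) \<in> proper_exact_factorizations scale \<Delta> S"
proof -
  have K: "subgroup K G" "g \<in> K" and \<Gamma>: "subgroup \<Gamma> G" "\<Gamma> \<noteq> {\<one>}" and int: "K \<inter> \<Gamma> = {\<one>}"
    using assms by (auto simp: group_exact_factorizations_def)
  have "K \<noteq> carrier G"
    using int \<Gamma> subgroup.subset[OF \<Gamma>(1)] by blast
  then have "filt K CHAR('k) \<noteq> UNIV"
    using filt_p_eq_UNIV_iff[OF subgroup.subset[OF K(1)]] by simp
  moreover have "filt \<Gamma> 1 \<noteq> UNIV"
    using x_notin_filt_1[OF subgroup.subset[OF \<Gamma>(1)]] by blast
  ultimately show ?thesis
    using exact_factorization_filt[OF assms] hopf_subalgebra_filt[OF K] hopf_subalgebra_filt_1[OF \<Gamma>(1)]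
    by (simp add: proper_exact_factorizations_def)
qed

text \<open>
  If all products lie in \<open>filt U p\<close>, surjectivity of multiplication makes this span all of \<open>H\<close>.
\<close>

lemma exact_factorization_group_cover:
  assumes ex: "exact_factorization scale B T" and U: "U \<subseteq> carrier G"
    and BT: "\<And>b t. b \<in> B \<Longrightarrow> t \<in> T \<Longrightarrow> b * t \<in> filt U CHAR('k)"
  shows "U = carrier G"
proof -
  have "span ((\<lambda>(b, t). b * t) ` (B \<times> T)) \<subseteq> filt U CHAR('k)"
    using BT by (intro span_minimal) auto
  then show ?thesis
    using exact_factorization_span[OF ex] filt_p_eq_UNIV_iff[OF U] by auto
qed

text \<open>
  Any \<open>h \<in> B \<inter> T\<close> that is linearly independent of \<open>1\<close> would contradict \<open>exact_factorization_common\<close>;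
  the relevant \<open>h\<close> are \<open>x\<close> and the elements \<open>t \<noteq> 1\<close> of \<open>G\<close>.
\<close>

lemma grouplikes_inter:
  assumes ex: "exact_factorization scale B T"
    and B: "hopf_subalgebra scale \<Delta> S B" and T: "hopf_subalgebra scale \<Delta> S T"
  shows "grouplikes B \<inter> grouplikes T = {\<one>}" and "\<not> (x \<in> B \<and> x \<in> T)"
proof -
  have one: "1 \<in> B" "1 \<in> T" using B T by (auto simp: hopf_subalgebra_def)
  note common = exact_factorization_common[OF ex _ _ one linear_coord linear_coord]
  have coord_1: "coord i t 1 = (if i = 0 \<and> t = \<one> then 1 else 0)"
    if "i < CHAR('k)" "t \<in> carrier G" for i t
    using coord_iota[of i t \<one>] that by (simp add: iota_one)
  have "s = \<one>" if "s \<in> grouplikes B" "s \<in> grouplikes T" for s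
  proof (rule ccontr)
    assume "s \<noteq> \<one>"
    then show False
      using common[of "\<iota> s" 0 s 0 \<one>] that CHAR_pos by (auto simp: grouplikes_def coord_1 coord_iota)
  qed
  moreover have "\<one> \<in> grouplikes B \<inter> grouplikes T"
    using one by (simp add: grouplikes_def iota_one)
  ultimately show "grouplikes B \<inter> grouplikes T = {\<one>}" by blast
  show "\<not> (x \<in> B \<and> x \<in> T)"
  proof
    assume "x \<in> B \<and> x \<in> T"
    then show False
      using common[of x 1 \<one> 0 \<one>] p_gt_1 coord_x_power[of 1 \<one> 1] coord_x_power[of 0 \<one> 1]
      by (simp add: coord_1)
  qed
qed

text \<open>
  Exactly one of the factors contains \<open>x\<close>: not both by injectivity, and not neither, because then the
  products would stay in \<open>k[G]\<close>.  The factor with \<open>x\<close> may be the left or the right one.  In the second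
  case, products \<open>c x\<^sup>i u\<close> have to be brought into normal form, which stays within \<open>filt\<close> of the product
  set because \<open>g\<close> is central and lies in the group of the second factor; and the group factorization
  is turned around by inversion.
\<close>

lemma exact_factorization_cases:
  assumes BT: "(B, T) \<in> proper_exact_factorizations scale \<Delta> S"
  shows "{B, T} \<in> (\<lambda>(K, \<Gamma>). {filt K CHAR('k), filt \<Gamma> 1}) ` group_exact_factorizations G g"
proof -
  have B: "hopf_subalgebra scale \<Delta> S B" and T: "hopf_subalgebra scale \<Delta> S T"
    and ne: "B \<noteq> UNIV" "T \<noteq> UNIV" and ex: "exact_factorization scale B T"
    using BT by (auto simp: proper_exact_factorizations_def)
  let ?K = "grouplikes B" and ?L = "grouplikes T"
  note sub = subgroup_grouplikes[OF B] subgroup_grouplikes[OF T]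
  note subset = sub[THEN subgroup.subset]
  note mem = sub[THEN subgroup.mem_carrier]
  note int = grouplikes_inter[OF ex B T]
  have KL: "?K <#> ?L \<subseteq> carrier G" using subset by (auto simp: set_mult_def)
  have neq_one: "\<Gamma> \<noteq> {\<one>}" if "subgroup K G" "carrier G = K <#> \<Gamma>" "filt K CHAR('k) \<noteq> UNIV" for K \<Gamma>
  proof
    assume "\<Gamma> = {\<one>}"
    then have "carrier G = K"
      using that(2) subgroup.mem_carrier[OF that(1)] by (auto simp: set_mult_def)
    then show False using that(3) filt_carrier by simp
  qed
  consider (left) "x \<in> B" "x \<notin> T" | (right) "x \<notin> B" "x \<in> T" | (neither) "x \<notin> B" "x \<notin> T"
    using int(2) by blast
  then show ?thesis
  proof cases
    case left
    have eq: "B = filt ?K CHAR('k)" "T = filt ?L 1" and g: "g \<in> ?K"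
      using hopf_subalgebra_classification[OF B] hopf_subalgebra_classification[OF T] left by blast+
    have "b * t \<in> filt (?K <#> ?L) CHAR('k)" if "b \<in> filt ?K CHAR('k)" "t \<in> filt ?L 1" for b t
    proof -
      have "x ^ i * \<iota> k * \<iota> c \<in> filt (?K <#> ?L) CHAR('k)"
        if "i < CHAR('k)" "k \<in> ?K" "c \<in> ?L" for i k c
        using that mem filt_base[of i "CHAR('k)" "k \<otimes> c" "?K <#> ?L"]
        by (auto simp: set_mult_def mult.assoc iota_mult)
      then have "filt ?K CHAR('k) \<subseteq> {b. b * \<iota> c \<in> filt (?K <#> ?L) CHAR('k)}" if "c \<in> ?L" for c
        using that by (intro filt_minimal) (auto simp: subspace_right_mult_preimage)
      then have "filt ?L 1 \<subseteq> {t. b * t \<in> filt (?K <#> ?L) CHAR('k)}"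
        using that(1) by (intro filt_minimal) (auto simp: subspace_left_mult_preimage)
      then show ?thesis using that(2) by blast
    qed
    then have "?K <#> ?L = carrier G"
      using eq by (intro exact_factorization_group_cover[OF ex KL]) simp
    then have "(?K, ?L) \<in> group_exact_factorizations G g"
      using sub int(1) g neq_one[of ?K ?L] ne eq by (auto simp: group_exact_factorizations_def)
    moreover have "{filt ?K CHAR('k), filt ?L 1} = {B, T}" unfolding eq[symmetric] ..
    ultimately show ?thesis
      by (intro image_eqI[of _ _ "(?K, ?L)"]) (simp_all only: prod.case)
  next
    case right
    have eq: "B = filt ?K 1" "T = filt ?L CHAR('k)" and g: "g \<in> ?L"
      using hopf_subalgebra_classification[OF B] hopf_subalgebra_classification[OF T] right by blast+
    have g_stable: "g \<otimes> v \<in> ?K <#> ?L" if v: "v \<in> ?K <#> ?L" for v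
    proof -
      obtain k c where kc: "k \<in> ?K" "c \<in> ?L" "v = k \<otimes> c" using v by (auto simp: set_mult_def)
      have "g \<otimes> v = k \<otimes> (g \<otimes> c)"
        using kc mem g_central[of k] by (simp add: m_assoc[symmetric])
      moreover have "g \<otimes> c \<in> ?L" using g kc sub(2) by (simp add: subgroup.m_closed)
      ultimately show ?thesis using kc(1) by (auto simp: set_mult_def)
    qed
    have "b * t \<in> filt (?K <#> ?L) CHAR('k)" if "b \<in> filt ?K 1" "t \<in> filt ?L CHAR('k)" for b t
    proof -
      have "\<iota> k * t \<in> filt (?K <#> ?L) CHAR('k)" if "k \<in> ?K" for k
        using that \<open>t \<in> filt ?L CHAR('k)\<close> mem subset
        by (intro iota_mult_filt[of _ ?L] g_stable) (auto simp: set_mult_def)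
      then have "filt ?K 1 \<subseteq> {b. b * t \<in> filt (?K <#> ?L) CHAR('k)}"
        by (intro filt_minimal) (auto simp: subspace_right_mult_preimage)
      then show ?thesis using that(1) by blast
    qed
    then have KL_G: "?K <#> ?L = carrier G"
      using eq by (intro exact_factorization_group_cover[OF ex KL]) simp
    have LK_G: "carrier G = ?L <#> ?K"
    proof
      show "carrier G \<subseteq> ?L <#> ?K"
      proof
        fix s assume s: "s \<in> carrier G"
        then have "inv s \<in> ?K <#> ?L" by (simp add: KL_G)
        then obtain k c where kc: "k \<in> ?K" "c \<in> ?L" "inv s = k \<otimes> c" by (auto simp: set_mult_def)
        then have "s = inv c \<otimes> inv k" using s mem by (metis inv_inv inv_mult_group)
        then show "s \<in> ?L <#> ?K"
          using kc sub by (auto simp: set_mult_def intro: subgroup.m_inv_closed)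
      qed
    qed (use subset in \<open>auto simp: set_mult_def\<close>)
    then have "(?L, ?K) \<in> group_exact_factorizations G g"
      using sub int(1) g neq_one[of ?L ?K] ne eq by (auto simp: group_exact_factorizations_def)
    moreover have "{filt ?L CHAR('k), filt ?K 1} = {B, T}"
      unfolding eq[symmetric] by (rule insert_commute)
    ultimately show ?thesis
      by (intro image_eqI[of _ _ "(?L, ?K)"]) (simp_all only: prod.case)
  next
    case neither
    have "b * t \<in> filt (carrier G) 1" if "b \<in> B" "t \<in> T" for b t
    proof -
      have "B \<subseteq> filt (carrier G) 1" "T \<subseteq> filt (carrier G) 1"
        using hopf_subalgebra_classification(2)[OF B] hopf_subalgebra_classification(2)[OF T] neither
          filt_mono[of 1 1 _ "carrier G"] subset by blast+
      then show ?thesis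
        using that hopf_subalgebra_filt_1[OF subgroup_self] by (auto simp: hopf_subalgebra_def)
    qed
    then have "span ((\<lambda>(b, t). b * t) ` (B \<times> T)) \<subseteq> filt (carrier G) 1"
      by (intro span_minimal) auto
    then show ?thesis
      using exact_factorization_span[OF ex] x_notin_filt_1[of "carrier G"] by auto
  qed
qed

text \<open>
  The two members of an unordered pair can be told apart by whether they contain \<open>x\<close>, and each of them
  determines its subgroup as the set of \<open>t\<close> with \<open>\<iota> t\<close> in it.
\<close>

theorem bij_betw_filt_pairs:
  "bij_betw (\<lambda>(K, \<Gamma>). {filt K CHAR('k), filt \<Gamma> 1}) (group_exact_factorizations G g)
     {{B, T} | B T. (B, T) \<in> proper_exact_factorizations scale \<Delta> S}"
  unfolding bij_betw_def
proof
  show "inj_on (\<lambda>(K, \<Gamma>). {filt K CHAR('k), filt \<Gamma> 1}) (group_exact_factorizations G g)"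
  proof (rule inj_onI, clarify)
    fix K \<Gamma> K' \<Gamma>'
    assume mem: "(K, \<Gamma>) \<in> group_exact_factorizations G g" "(K', \<Gamma>') \<in> group_exact_factorizations G g"
      and eq: "{filt K CHAR('k), filt \<Gamma> 1} = {filt K' CHAR('k), filt \<Gamma>' 1}"
    have sub: "subgroup K G" "subgroup \<Gamma> G" "subgroup K' G" "subgroup \<Gamma>' G"
      using mem by (auto simp: group_exact_factorizations_def)
    have xs: "x \<in> filt K CHAR('k)" "x \<in> filt K' CHAR('k)" "x \<notin> filt \<Gamma> 1" "x \<notin> filt \<Gamma>' 1"
      using sub by (auto intro: x_in_filt_p dest: x_notin_filt_1[OF subgroup.subset])
    then have "filt K CHAR('k) = filt K' CHAR('k)" "filt \<Gamma> 1 = filt \<Gamma>' 1"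
      using eq by (auto simp: doubleton_eq_iff)
    then have "t \<in> K \<longleftrightarrow> t \<in> K'" "t \<in> \<Gamma> \<longleftrightarrow> t \<in> \<Gamma>'" if "t \<in> carrier G" for t
      using iota_in_filt_iff[of K "CHAR('k)" t] iota_in_filt_iff[of K' "CHAR('k)" t]
        iota_in_filt_iff[of \<Gamma> 1 t] iota_in_filt_iff[of \<Gamma>' 1 t]
        sub[THEN subgroup.subset] that CHAR_pos by simp_all
    then show "K = K' \<and> \<Gamma> = \<Gamma>'"
      using sub[THEN subgroup.subset] by blast
  qed
  show "(\<lambda>(K, \<Gamma>). {filt K CHAR('k), filt \<Gamma> 1}) ` group_exact_factorizations G g
      = {{B, T} | B T. (B, T) \<in> proper_exact_factorizations scale \<Delta> S}"
  proof (intro equalityI subsetI)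
    fix P assume "P \<in> (\<lambda>(K, \<Gamma>). {filt K CHAR('k), filt \<Gamma> 1}) ` group_exact_factorizations G g"
    then obtain K \<Gamma> where "P = {filt K CHAR('k), filt \<Gamma> 1}" "(K, \<Gamma>) \<in> group_exact_factorizations G g"
      by auto
    then show "P \<in> {{B, T} | B T. (B, T) \<in> proper_exact_factorizations scale \<Delta> S}"
      using proper_exact_factorization_of_groups by blast
  next
    fix P assume "P \<in> {{B, T} | B T. (B, T) \<in> proper_exact_factorizations scale \<Delta> S}"
    then obtain B T where "P = {B, T}" "(B, T) \<in> proper_exact_factorizations scale \<Delta> S" by blast
    then show "P \<in> (\<lambda>(K, \<Gamma>). {filt K CHAR('k), filt \<Gamma> 1}) ` group_exact_factorizations G g"
      using exact_factorization_cases by simp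
  qed
qed

end

theorem theorem1p3:
  fixes scale :: "'k::alg_closed_field \<Rightarrow> 'h::ring_1 \<Rightarrow> 'h"
    and \<Delta> :: "'h \<Rightarrow> ('h \<times> 'h \<Rightarrow>\<^sub>0 'k)" and \<epsilon> :: "'h \<Rightarrow> 'k" and S :: "'h \<Rightarrow> 'h"
    and G :: "('g, 'm) monoid_scheme" and g :: 'g and f :: "'g \<Rightarrow> 'k"
    and \<iota> :: "'g \<Rightarrow> 'h" and x :: 'h
  assumes "CHAR('k) > 0"
    and "third_type_datum G g f"
    and "third_type_hopf_algebra scale \<Delta> \<epsilon> S G g f \<iota> x"
  shows "(\<forall>(G\<^sub>B, \<Gamma>) \<in> group_exact_factorizations G g.
            (third_type_sub scale \<Delta> S \<iota> x G\<^sub>B, group_algebra_sub scale \<iota> \<Gamma>)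
              \<in> proper_exact_factorizations scale \<Delta> S) \<and>
         bij_betw (\<lambda>(G\<^sub>B, \<Gamma>). {third_type_sub scale \<Delta> S \<iota> x G\<^sub>B, group_algebra_sub scale \<iota> \<Gamma>})
           (group_exact_factorizations G g)
           {{B, T} | B T. (B, T) \<in> proper_exact_factorizations scale \<Delta> S}"
proof -
  interpret third_type_setting scale \<Delta> \<epsilon> S G g f \<iota> x
    using assms by (intro third_type_setting.intro third_type_setting_axioms.intro)
  have eq: "(third_type_sub scale \<Delta> S \<iota> x K, group_algebra_sub scale \<iota> \<Gamma>) = (filt K CHAR('k), filt \<Gamma> 1)"
    if "(K, \<Gamma>) \<in> group_exact_factorizations G g" for K \<Gamma>
    using that third_type_sub_filt[of K] group_algebra_filt[of \<Gamma>]
    by (auto simp: group_exact_factorizations_def)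
  show ?thesis
  proof
    show "\<forall>(K, \<Gamma>)\<in>group_exact_factorizations G g.
        (third_type_sub scale \<Delta> S \<iota> x K, group_algebra_sub scale \<iota> \<Gamma>)
          \<in> proper_exact_factorizations scale \<Delta> S"
      using proper_exact_factorization_of_groups eq by auto
    show "bij_betw (\<lambda>(K, \<Gamma>). {third_type_sub scale \<Delta> S \<iota> x K, group_algebra_sub scale \<iota> \<Gamma>})
        (group_exact_factorizations G g)
        {{B, T} | B T. (B, T) \<in> proper_exact_factorizations scale \<Delta> S}"
      by (rule bij_betw_cong[THEN iffD1, OF _ bij_betw_filt_pairs]) (use eq in auto)
  qed
qed

end
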